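(* Suppose $\ell_\theta$ is $\gamma_\theta$-strongly convex in $\theta$ and $L_\theta$-smooth in $(x,y)$ and $\theta$; $\ell_\phi$ is $\gamma_\phi$-strongly convex in $\phi$ and $L_\phi$-smooth in $(x,y)$ and $\phi$; $P(\theta,\phi)$ is $\varepsilon_\theta$-sensitive and $Q(\theta,\phi)$ is $\varepsilon_\phi$-sensitive; and $$\kappa=\max\left(\frac{\gamma_\theta L_\phi\varepsilon_\phi+2\gamma_\phi L_\theta\varepsilon_\theta}{\gamma_\phi(\gamma_\theta-L_\theta\varepsilon_\theta)},\ \frac{\gamma_\phi L_\theta\varepsilon_\theta+2\gamma_\theta L_\phi\varepsilon_\phi}{\gamma_\theta(\gamma_\phi-L_\phi\varepsilon_\phi)},\ \frac{L_\theta\varepsilon_\theta}{\gamma_\theta}+\frac{L_\phi\varepsilon_\phi}{\gamma_\phi}\right)<1.$$ Let $\tau_q=\gamma_\phi-L_\phi\varepsilon_\phi-\frac{L_\theta\varepsilon_\theta L_\phi\varepsilon_\phi}{\gamma_\theta-L_\theta\varepsilon_\theta}$ and let $m_q$ be the minimal eigenvalue of $\frac{S_q+S_q^T}{2}$. Then $\|S_q\|\le\frac1{\tau_q}$, and if $|\rho_q|>\frac{1}{\sqrt{1+m_q^2\tau_q^2}}$, then $$\operatorname{sign}(\rho_q)\cdot\frac{\partial J_q(\phi^* )}{\partial\lambda_{\mathcal H}^\theta}>0.$$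
   Context: Models. $\Theta,\Phi$ are closed convex subsets of Euclidean spaces; model $\theta\in\Theta$ outputs $x\sim p_\theta(x|y)$, model $\phi\in\Phi$ outputs $y\sim q_\phi(y|x)$; losses $\ell_\theta(x,y)$, $\ell_\phi(x,y)$; reward $r_\phi(x,y)$. Training distributions. $P(\theta,\phi)=\lambda_{\mathcal R}^\theta P_{\mathcal R}+\lambda_{\mathcal S}^\theta P_{\mathcal S}(\theta,\phi)+\lambda_{\mathcal H}^\theta P_{\mathcal H}(\theta,\phi)$ is the training distribution of model $\theta$: a mixture of the fixed real-data distribution $P_{\mathcal R}$, the distribution $P_{\mathcal S}(\theta,\phi)$ of synthetic data generated by the models, and the distribution $P_{\mathcal H}(\theta,\phi)$ of human-curated synthetic data, with nonnegative weights summing to 1. Similarly $Q(\theta,\phi)=\lambda_{\mathcal R}^\phi Q_{\mathcal R}+\lambda_{\mathcal S}^\phi Q_{\mathcal S}(\theta,\phi)+\lambda_{\mathcal H}^\phi Q_{\mathcal H}(\theta,\phi)$ for model $\phi$. The component distributions are treated as functions of $(\theta,\phi)$ only, not of the mixing weights. A stable point $(\theta^*,\phi^* )$ satisfies $\theta^*=\arg\min_\theta\mathbb E_{P(\theta^*,\phi^* )}[\ell_\theta]$, $\phi^*=\arg\min_\phi\mathbb E_{Q(\theta^*,\phi^* )}[\ell_\phi]$; $P_{\mathcal H}$ below denotes $P_{\mathcal H}(\theta^*,\phi^* )$. Variation of $\lambda_{\mathcal H}^\theta$. Only the size of model $\theta$'s curated dataset changes, all other data sources being fixed: the ratio $\lambda_{\mathcal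 S}^\theta:\lambda_{\mathcal R}^\theta$ and all weights of model $\phi$ and cross-model fractions stay fixed, and $\lambda_{\mathcal H}^\theta<1$. The stable point is viewed as a function of $\lambda_{\mathcal H}^\theta$. $J_q(\phi)=\mathbb E_{x\sim\mathcal E_\phi,\,y\sim q_\phi(y|x)}[r_\phi(x,y)]$ with a fixed evaluation distribution $\mathcal E_\phi$. $\rho_q=\cos\big(\nabla_\phi J_q(\phi^* ),\ C_q\,\mathbb E_{P_{\mathcal H}}[-\nabla_\theta\ell_\theta(\theta^* )]\big)\in[-1,1]$ is the cosine of the angle between the two (nonzero) vectors. $F_p(\theta,\phi,\lambda_{\mathcal H}^\theta)=\mathbb E_{P(\theta,\phi)}[\nabla_\theta\ell_\theta(x,y)]$, $F_q(\theta,\phi,\lambda_{\mathcal H}^\theta)=\mathbb E_{Q(\theta,\phi)}[\nabla_\phi\ell_\phi(x,y)]$; $\nabla_\theta\mathbf F_p,\nabla_\phi\mathbf F_p,\nabla_\theta\mathbf F_q,\nabla_\phi\mathbf F_q$ are their Jacobians at $(\theta^*,\phi^*,\lambda_{\mathcal H}^\theta)$; $S_q=(\nabla_\phi\mathbf F_q-\nabla_\theta\mathbf F_q(\nabla_\theta\mathbf F_p)^{-1}\nabla_\phi\mathbf F_p)^{-1}$, $C_q=-\nabla_\theta\mathbf F_q(\nabla_\theta\mathbf F_p)^{-1}$. $\|\cdot\|$ of a matrix is the operator norm. Standing conventions: all functions are differentiable as needed, the stable point is a differentiable function of $\lambda_{\mathcal H}^\theta$, and $F_p=F_q=0$ at $(\theta^*,\phi^*,\lambda_{\mathcal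 H}^\theta)$ for every $\lambda_{\mathcal H}^\theta$ considered. Strong convexity: $\ell_\theta(\theta)\ge\ell_\theta(\theta')+\nabla_\theta\ell_\theta(\theta')^T(\theta-\theta')+\frac{\gamma_\theta}{2}\|\theta-\theta'\|^2$, $\gamma_\theta>0$ (similarly $\phi$). Smoothness: $\|\nabla_\theta\ell_\theta(x,y)-\nabla_\theta\ell_\theta(x',y')\|\le L_\theta\|(x,y)-(x',y')\|$ and $\|\nabla_\theta\ell_\theta(\theta)-\nabla_\theta\ell_\theta(\theta')\|\le L_\theta\|\theta-\theta'\|$ (similarly $\phi$). Sensitivity: $W(P(\theta,\phi),P(\theta',\phi'))\le\varepsilon_\theta\|(\theta,\phi)-(\theta',\phi')\|$ and $W(Q(\theta,\phi),Q(\theta',\phi'))\le\varepsilon_\phi\|(\theta,\phi)-(\theta',\phi')\|$, $W$ the Wasserstein-1 distance. *)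

theory Defs
  imports "HOL-Probability.Probability"
begin

definition mixture ::
  "real \<Rightarrow> real \<Rightarrow> real \<Rightarrow> 'z measure \<Rightarrow> 'z measure \<Rightarrow> 'z measure \<Rightarrow> 'z::topological_space measure"
where
  "mixture a b c R S H = measure_of UNIV (sets borel)
     (\<lambda>E. ennreal a * emeasure R E + ennreal b * emeasure S E + ennreal c * emeasure H E)"

lemma sets_mixture [simp]: "sets (mixture a b c R S H) = sets borel"
  unfolding mixture_def using sets.sigma_sets_eq[of borel] by (simp add: sets_measure_of_conv)

lemma emeasure_mixture:
  assumes "sets R = sets borel" "sets S = sets borel" "sets H = sets borel" "E \<in> sets borel"
  shows "emeasure (mixture a b c R S H) E
    = ennreal a * emeasure R E + ennreal b * emeasure S E + ennreal c * emeasure H E"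
proof (rule emeasure_measure_of[OF mixture_def])
  show "countably_additive (sets (mixture a b c R S H))
     (\<lambda>E. ennreal a * emeasure R E + ennreal b * emeasure S E + ennreal c * emeasure H E)"
  proof (rule countably_additiveI)
    fix A :: "nat \<Rightarrow> 'a set"
    assume A: "range A \<subseteq> sets (mixture a b c R S H)" "disjoint_family A"
    have "(\<Sum>i. emeasure M (A i)) = emeasure M (\<Union>i. A i)" if "sets M = sets borel" for M
      using A that by (intro suminf_emeasure) auto
    then show "(\<Sum>i. ennreal a * emeasure R (A i) + ennreal b * emeasure S (A i)
          + ennreal c * emeasure H (A i))
       = ennreal a * emeasure R (\<Union>i. A i) + ennreal b * emeasure S (\<Union>i. A i)
          + ennreal c * emeasure H (\<Union>i. A i)"
      using assms by (simp add: suminf_add[symmetric] summableI)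
  qed
qed (use assms in \<open>auto simp: positive_def\<close>)

definition couplings :: "'z measure \<Rightarrow> 'z measure \<Rightarrow> ('z \<times> 'z) measure set" where
  "couplings M N = {G. sets G = sets (M \<Otimes>\<^sub>M N) \<and> distr G M fst = M \<and> distr G N snd = N}"

definition wasserstein1 :: "'z::metric_space measure \<Rightarrow> 'z measure \<Rightarrow> ennreal" where
  "wasserstein1 M N = (INF G\<in>couplings M N. \<integral>\<^sup>+w. ennreal (dist (fst w) (snd w)) \<partial>G)"

text \<open>
  The gradient is taken within the parameter set \<open>T\<close>, so that it also makes sense at
  boundary points; it is unique when \<open>T\<close> is convex with nonempty interior.
\<close>

definition grad_within :: "'a::real_inner set \<Rightarrow> ('a \<Rightarrow> real) \<Rightarrow> 'a \<Rightarrow> 'a" where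
  "grad_within T f t = (THE g. (f has_derivative (\<lambda>h. g \<bullet> h)) (at t within T))"

definition loss_grad :: "'a::real_inner set \<Rightarrow> ('a \<Rightarrow> 'z \<Rightarrow> real) \<Rightarrow> 'a \<Rightarrow> 'z \<Rightarrow> 'a" where
  "loss_grad T l t z = grad_within T (\<lambda>s. l s z) t"

definition strongly_convex_loss ::
  "real \<Rightarrow> 'a::real_inner set \<Rightarrow> ('a \<Rightarrow> 'z \<Rightarrow> real) \<Rightarrow> bool"
where
  "strongly_convex_loss \<gamma> T l \<longleftrightarrow> \<gamma> > 0 \<and>
     (\<forall>z. \<forall>t\<in>T. \<forall>s\<in>T.
        l t z \<ge> l s z + loss_grad T l s z \<bullet> (t - s) + \<gamma> / 2 * (norm (t - s))\<^sup>2)"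

definition smooth_loss ::
  "real \<Rightarrow> 'a::real_inner set \<Rightarrow> ('a \<Rightarrow> 'z::real_normed_vector \<Rightarrow> real) \<Rightarrow> bool"
where
  "smooth_loss L T l \<longleftrightarrow>
     (\<forall>t\<in>T. \<forall>z w. norm (loss_grad T l t z - loss_grad T l t w) \<le> L * norm (z - w)) \<and>
     (\<forall>z. \<forall>t\<in>T. \<forall>s\<in>T. norm (loss_grad T l t z - loss_grad T l s z) \<le> L * norm (t - s))"

text \<open>
  Nonnegativity of \<open>\<epsilon>\<close> is made explicit because \<open>ennreal\<close> truncates negative reals to 0.
\<close>

definition sensitive ::
  "real \<Rightarrow> 'a::real_normed_vector set \<Rightarrow> 'b::real_normed_vector set
    \<Rightarrow> ('a \<Rightarrow> 'b \<Rightarrow> 'z::metric_space measure) \<Rightarrow> bool"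
where
  "sensitive \<epsilon> T U D \<longleftrightarrow> \<epsilon> \<ge> 0 \<and>
     (\<forall>t\<in>T. \<forall>u\<in>U. \<forall>t'\<in>T. \<forall>u'\<in>U.
        wasserstein1 (D t u) (D t' u') \<le> ennreal (\<epsilon> * norm ((t, u) - (t', u'))))"

definition stable_point ::
  "'a set \<Rightarrow> 'b set \<Rightarrow> ('a \<Rightarrow> 'z \<Rightarrow> real) \<Rightarrow> ('b \<Rightarrow> 'z \<Rightarrow> real)
    \<Rightarrow> ('a \<Rightarrow> 'b \<Rightarrow> 'z measure) \<Rightarrow> ('a \<Rightarrow> 'b \<Rightarrow> 'z measure) \<Rightarrow> 'a \<Rightarrow> 'b \<Rightarrow> bool"
where
  "stable_point T U l m P Q t u \<longleftrightarrow>
     is_arg_min (\<lambda>t'. LINT z|P t u. l t' z) (\<lambda>t'. t' \<in> T) t \<and>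
     is_arg_min (\<lambda>u'. LINT z|Q t u. m u' z) (\<lambda>u'. u' \<in> U) u"

definition joint_law ::
  "'x measure \<Rightarrow> ('x \<Rightarrow> 'y measure) \<Rightarrow> ('x::topological_space \<times> 'y::topological_space) measure"
where
  "joint_law E k = bind E (\<lambda>x. bind (k x) (\<lambda>y. return borel (x, y)))"

definition cosine :: "'a::real_inner \<Rightarrow> 'a \<Rightarrow> real" where
  "cosine v w = v \<bullet> w / (norm v * norm w)"

definition min_eigenvalue :: "real^'n^'n \<Rightarrow> real" where
  "min_eigenvalue A = (LEAST c. \<exists>v. v \<noteq> 0 \<and> A *v v = c *\<^sub>R v)"

end

theory Submission
  imports Defs
begin

text \<open>
  The easy half of Kantorovich duality makes the mean gradients Lipschitz in the distribution, so
  with strong convexity the Jacobian of \<open>F\<^sub>p\<close> in \<open>\<theta>\<close> is coercive with constant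
  \<open>\<gamma>\<theta> - L\<theta> \<epsilon>\<theta>\<close>, that of \<open>F\<^sub>q\<close> in \<open>\<phi>\<close> with constant
  \<open>\<gamma>\<phi> - L\<phi> \<epsilon>\<phi>\<close>, and the mixed Jacobians have norms at most
  \<open>L\<theta> \<epsilon>\<theta>\<close> and \<open>L\<phi> \<epsilon>\<phi>\<close>. Hence the Schur complement
  \<open>S\<^sub>q\<inverse>\<close> is coercive with constant \<open>\<tau>\<^sub>q\<close>. Differentiating the stationarity
  equations in the curated weight \<open>h\<close> gives \<open>\<phi>' = S\<^sub>q v / (1 - h)\<close>. Splitting
  \<open>\<nabla>J\<^sub>q\<close> into its components along and across \<open>v\<close>, the former contributes at least
  \<open>m\<^sub>q \<bar>\<rho>\<^sub>q\<bar>\<close> to \<open>\<nabla>J\<^sub>q \<bullet> S\<^sub>q v\<close> and the latter at most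
  \<open>sqrt (1 - \<rho>\<^sub>q\<^sup>2) / \<tau>\<^sub>q\<close>, relative to \<open>\<parallel>\<nabla>J\<^sub>q\<parallel> \<parallel>v\<parallel>\<close>.
\<close>

subsection \<open>Mixtures and the Wasserstein distance\<close>

lemma mixture_in_prob_algebra:
  fixes R S H :: "'z::topological_space measure"
  assumes "R \<in> space (prob_algebra borel)" "S \<in> space (prob_algebra borel)"
    "H \<in> space (prob_algebra borel)"
    and w: "a \<ge> 0" "b \<ge> 0" "c \<ge> 0" "a + b + c = 1"
  shows "mixture a b c R S H \<in> space (prob_algebra borel)"
proof -
  have s: "sets R = sets borel" "sets S = sets borel" "sets H = sets borel"
    and p: "prob_space R" "prob_space S" "prob_space H"
    using assms by (auto simp: space_prob_algebra)
  have "emeasure M UNIV = 1" if "sets M = sets borel" "prob_space M" for M :: "'z measure"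
    using prob_space.emeasure_space_1[OF that(2)] sets_eq_imp_space_eq[OF that(1)] by simp
  with s p have "emeasure (mixture a b c R S H) UNIV = ennreal a + ennreal b + ennreal c"
    by (simp add: emeasure_mixture)
  also have "\<dots> = 1"
    using w by (simp flip: ennreal_plus)
  finally have "prob_space (mixture a b c R S H)"
    using sets_eq_imp_space_eq[OF sets_mixture, of a b c R S H] by (intro prob_spaceI) simp
  then show ?thesis
    by (simp add: space_prob_algebra)
qed

text \<open>Both sides respect sums, nonnegative multiples and increasing suprema, so indicators
  suffice, and there the defining formula of \<open>mixture\<close> applies.\<close>

lemma nn_integral_mixture:
  fixes f :: "'z::topological_space \<Rightarrow> ennreal"
  assumes s: "sets R = sets borel" "sets S = sets borel" "sets H = sets borel"
    and f: "f \<in> borel_measurable borel"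
  shows "(\<integral>\<^sup>+z. f z \<partial>mixture a b c R S H)
    = ennreal a * (\<integral>\<^sup>+z. f z \<partial>R) + ennreal b * (\<integral>\<^sup>+z. f z \<partial>S) + ennreal c * (\<integral>\<^sup>+z. f z \<partial>H)"
proof -
  have cong: "borel_measurable M = (borel_measurable borel :: ('z \<Rightarrow> ennreal) set)"
    if "sets M = sets (borel :: 'z measure)" for M
    using that by (rule measurable_cong_sets) simp
  note m = cong[OF s(1)] cong[OF s(2)] cong[OF s(3)] cong[OF sets_mixture[of a b c R S H]]
  from f show ?thesis
  proof (induction rule: borel_measurable_induct)
    case (cong f g)
    then show ?case by (metis UNIV_I ext space_borel)
  next
    case (set A)
    then show ?case using s by (simp add: emeasure_mixture)
  next
    case (mult u c)
    then show ?case by (simp add: m nn_integral_cmult distrib_left ac_simps)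
  next
    case (add u v)
    then show ?case by (simp add: m nn_integral_add distrib_left ac_simps)
  next
    case (seq U)
    have nn: "(\<integral>\<^sup>+z. (SUP i. U i) z \<partial>M) = (SUP i. \<integral>\<^sup>+z. U i z \<partial>M)" and
      inc: "incseq (\<lambda>i. \<integral>\<^sup>+z. U i z \<partial>M)"
      if "sets M = sets (borel :: 'z measure)" for M
      using seq that cong[OF that]
      by (auto simp: nn_integral_monotone_convergence_SUP image_comp mono_def le_fun_def
          intro!: nn_integral_mono)
    show ?case
      unfolding \<open>f = Sup (range U)\<close> nn[OF s(1)] nn[OF s(2)] nn[OF s(3)] nn[OF sets_mixture] seq.IH
      using inc[OF s(1)] inc[OF s(2)] inc[OF s(3)]
      by (simp add: ennreal_SUP_add SUP_mult_left_ennreal mono_def mult_left_mono add_mono)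
  qed
qed

text \<open>Integrability only concerns the nonnegative integral of the norm. The formula for the
  value is proved coordinatewise, splitting each real coordinate into positive and negative
  part.\<close>

lemma
  fixes f :: "'z::topological_space \<Rightarrow> 'b::euclidean_space"
  assumes s: "sets R = sets borel" "sets S = sets borel" "sets H = sets borel"
    and w: "a \<ge> 0" "b \<ge> 0" "c \<ge> 0"
    and f: "integrable R f" "integrable S f" "integrable H f"
  shows integrable_mixture: "integrable (mixture a b c R S H) f" (is ?int)
    and integral_mixture: "(LINT z|mixture a b c R S H. f z)
      = a *\<^sub>R (LINT z|R. f z) + b *\<^sub>R (LINT z|S. f z) + c *\<^sub>R (LINT z|H. f z)" (is ?eq)
proof -
  have meas: "f \<in> borel_measurable borel"
    using f(1) s(1) by (metis borel_measurable_integrable measurable_cong_sets)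
  then have meas': "f \<in> borel_measurable (mixture a b c R S H)"
    by (metis measurable_cong_sets sets_mixture)
  show int: ?int
    using f meas meas' unfolding integrable_iff_bounded
    by (auto simp: nn_integral_mixture[OF s] ennreal_mult_less_top)
  have real: "(LINT z|mixture a b c R S H. g z)
      = a * (LINT z|R. g z) + b * (LINT z|S. g z) + c * (LINT z|H. g z)"
    if g: "integrable R g" "integrable S g" "integrable H g" "integrable (mixture a b c R S H) g"
      and gm: "g \<in> borel_measurable borel" for g :: "'z \<Rightarrow> real"
  proof -
    have fin: "(\<integral>\<^sup>+z. ennreal (g z) \<partial>M) < top" "(\<integral>\<^sup>+z. ennreal (- g z) \<partial>M) < top"
      if "integrable M g" for M
      using that by (auto simp: real_integrable_def less_top)
    note fins = fin[OF g(1)] fin[OF g(2)] fin[OF g(3)]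
    \<comment> \<open>\<open>enn2real\<close> is additive only on finite values, which is why
      \<open>fins\<close> is collected first.\<close>
    have lin: "enn2real (ennreal a * x + ennreal b * y + ennreal c * z)
        = a * enn2real x + b * enn2real y + c * enn2real z"
      if "x < top" "y < top" "z < top" for x y z
      using that w by (simp add: enn2real_plus ennreal_mult_less_top enn2real_mult)
    show ?thesis
      using gm by (simp add: real_lebesgue_integral_def[OF g(1)] real_lebesgue_integral_def[OF g(2)]
          real_lebesgue_integral_def[OF g(3)] real_lebesgue_integral_def[OF g(4)]
          nn_integral_mixture[OF s] lin fins right_diff_distrib)
  qed
  show ?eq
  proof (rule euclidean_eqI)
    fix k :: 'b assume "k \<in> Basis"
    show "(LINT z|mixture a b c R S H. f z) \<bullet> k = (a *\<^sub>R (LINT z|R. f z) + b *\<^sub>R (LINT z|S. f z)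
        + c *\<^sub>R (LINT z|H. f z)) \<bullet> k"
      using real[of "\<lambda>z. f z \<bullet> k"] f int meas
      by (simp add: inner_add_left flip: integral_inner_left)
  qed
qed

text \<open>Over a coupling \<open>G\<close> both means become integrals against the same measure,
  so the Lipschitz bound applies pointwise. The infimum over couplings need not be attained, hence a
  near-optimal \<open>G\<close> and a slack that tends to zero.\<close>

lemma norm_integral_diff_le_wasserstein1:
  fixes f :: "'z::{metric_space, second_countable_topology} \<Rightarrow> 'b::euclidean_space"
  assumes s: "sets M = sets borel" "sets N = sets borel"
    and int: "integrable M f" "integrable N f"
    and lip: "\<And>z w. norm (f z - f w) \<le> L * dist z w" and "L \<ge> 0"
    and W: "wasserstein1 M N \<le> ennreal e" and "e \<ge> 0"
  shows "norm ((LINT z|M. f z) - (LINT z|N. f z)) \<le> L * e"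
proof -
  have *: "ennreal (norm ((LINT z|M. f z) - (LINT z|N. f z)))
      \<le> ennreal L * (\<integral>\<^sup>+w. ennreal (dist (fst w) (snd w)) \<partial>G)" if "G \<in> couplings M N" for G
  proof -
    from that have G: "sets G = sets (M \<Otimes>\<^sub>M N)" "distr G M fst = M" "distr G N snd = N"
      by (auto simp: couplings_def)
    have fs: "fst \<in> G \<rightarrow>\<^sub>M M" "snd \<in> G \<rightarrow>\<^sub>M N"
      using G(1) by (auto cong: measurable_cong_sets)
    have i: "integrable G (\<lambda>w. f (fst w))" "integrable G (\<lambda>w. f (snd w))"
      using integrable_distr[OF fs(1), of f] integrable_distr[OF fs(2), of f] G int by auto
    have "(LINT z|M. f z) = (LINT w|G. f (fst w))" "(LINT z|N. f z) = (LINT w|G. f (snd w))"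
      using integral_distr[OF fs(1), of f] integral_distr[OF fs(2), of f] G int by auto
    then have "(LINT z|M. f z) - (LINT z|N. f z) = (LINT w|G. f (fst w) - f (snd w))"
      using i by simp
    then have "ennreal (norm ((LINT z|M. f z) - (LINT z|N. f z)))
        \<le> (\<integral>\<^sup>+w. ennreal (norm (f (fst w) - f (snd w))) \<partial>G)"
      using integral_norm_bound_ennreal[of G "\<lambda>w. f (fst w) - f (snd w)"] i by simp
    also have "\<dots> \<le> (\<integral>\<^sup>+w. ennreal L * ennreal (dist (fst w) (snd w)) \<partial>G)"
      using lip \<open>L \<ge> 0\<close> by (intro nn_integral_mono) (simp flip: ennreal_mult)
    also have "\<dots> = ennreal L * (\<integral>\<^sup>+w. ennreal (dist (fst w) (snd w)) \<partial>G)"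
    proof (rule nn_integral_cmult)
      have "fst \<in> G \<rightarrow>\<^sub>M borel" "snd \<in> G \<rightarrow>\<^sub>M borel"
        using fs s measurable_cong_sets by blast+
      then show "(\<lambda>w. ennreal (dist (fst w) (snd w))) \<in> borel_measurable G"
        by measurable
    qed
    finally show ?thesis .
  qed
  show ?thesis
  proof (rule field_le_epsilon)
    fix \<eta> :: real assume "\<eta> > 0"
    \<comment> \<open>Dividing by \<open>L + 1\<close> rather than \<open>L\<close> covers the case
      \<open>L = 0\<close>.\<close>
    define d where "d = \<eta> / (L + 1)"
    have d: "d > 0" "L * d \<le> \<eta>"
      using \<open>\<eta> > 0\<close> \<open>L \<ge> 0\<close> by (auto simp: d_def field_simps)
    have "wasserstein1 M N < ennreal (e + d)"
      using W d \<open>e \<ge> 0\<close> by (meson ennreal_lessI le_less_trans less_add_same_cancel1 add_nonneg_pos)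
    then obtain G where G: "G \<in> couplings M N"
      "(\<integral>\<^sup>+w. ennreal (dist (fst w) (snd w)) \<partial>G) < ennreal (e + d)"
      unfolding wasserstein1_def INF_less_iff by blast
    have "ennreal (norm ((LINT z|M. f z) - (LINT z|N. f z))) \<le> ennreal L * ennreal (e + d)"
      using *[OF G(1)] G(2) by (meson mult_left_mono less_imp_le order_trans zero_le)
    also have "\<dots> = ennreal (L * (e + d))"
      using \<open>L \<ge> 0\<close> \<open>e \<ge> 0\<close> d by (simp add: ennreal_mult)
    finally have "norm ((LINT z|M. f z) - (LINT z|N. f z)) \<le> L * (e + d)"
      using \<open>L \<ge> 0\<close> \<open>e \<ge> 0\<close> d by (simp add: ennreal_le_iff)
    then show "norm ((LINT z|M. f z) - (LINT z|N. f z)) \<le> L * e + \<eta>"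
      using d(2) by (simp add: distrib_left)
  qed
qed

subsection \<open>Derivatives within convex sets\<close>

lemma has_derivative_compose_within:
  assumes "(f has_derivative f') (at x within S)" "(g has_derivative g') (at (f x) within T)"
    and "\<And>y. y \<in> S \<Longrightarrow> f y \<in> T"
  shows "((\<lambda>y. g (f y)) has_derivative (\<lambda>h. g' (f' h))) (at x within S)"
  by (rule has_derivative_in_compose[OF assms(1) has_derivative_subset[OF assms(2)]])
    (use assms(3) in blast)

text \<open>The segment from \<open>x\<close> to \<open>y\<close> stays in \<open>S\<close> by
  convexity. The limit is one-sided because \<open>x\<close> may lie on the boundary.\<close>

lemma has_derivative_ray_tendsto:
  fixes f :: "'a::real_normed_vector \<Rightarrow> 'b::real_normed_vector"
  assumes f: "(f has_derivative f') (at x within S)" and S: "convex S" "x \<in> S" "y \<in> S"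
  shows "((\<lambda>t. (f (x + t *\<^sub>R (y - x)) - f x) /\<^sub>R t) \<longlongrightarrow> f' (y - x)) (at_right 0)"
proof -
  have sub: "(\<lambda>t. x + t *\<^sub>R (y - x)) ` {0..1} \<subseteq> S"
    using convexD_alt[OF S] by (auto simp: algebra_simps)
  have lin: "f' (t *\<^sub>R v) = t *\<^sub>R f' v" for t v
    using f by (simp add: has_derivative_linear linear_cmul)
  have "((\<lambda>t. x + t *\<^sub>R (y - x)) has_derivative (\<lambda>t. t *\<^sub>R (y - x))) (at 0 within {0..1})"
    by (auto intro!: derivative_eq_intros)
  from has_derivative_in_compose[OF this, of f f'] f sub
  have "((\<lambda>t. f (x + t *\<^sub>R (y - x))) has_derivative (\<lambda>t. t *\<^sub>R f' (y - x))) (at 0 within {0..1})"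
    by (simp add: has_derivative_subset lin)
  then have "((\<lambda>t. (f (x + t *\<^sub>R (y - x)) - f x - t *\<^sub>R f' (y - x)) /\<^sub>R \<bar>t\<bar>) \<longlongrightarrow> 0) (at_right 0)"
    by (simp add: has_derivative_at_within at_within_Icc_at_right)
  then have "((\<lambda>t. (f (x + t *\<^sub>R (y - x)) - f x) /\<^sub>R t - f' (y - x)) \<longlongrightarrow> 0) (at_right 0)"
    by (rule Lim_transform_eventually)
      (auto simp: eventually_at_right_less scaleR_diff_right intro!: eventually_at_rightI[of 0 1])
  then show ?thesis
    by (rule LIM_zero_cancel)
qed

text \<open>The vector \<open>p - q\<close> need not point into \<open>S\<close> at
  \<open>x\<close>; moving from \<open>x\<close> towards \<open>p\<close> and towards
  \<open>q\<close> at the same speed realises it nevertheless.\<close>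

lemma has_derivative_chord_tendsto:
  fixes f :: "'a::real_normed_vector \<Rightarrow> 'b::real_normed_vector"
  assumes f: "(f has_derivative f') (at x within S)"
    and S: "convex S" "x \<in> S" "p \<in> S" "q \<in> S"
  shows "((\<lambda>t. (f (x + t *\<^sub>R (p - x)) - f (x + t *\<^sub>R (q - x))) /\<^sub>R t) \<longlongrightarrow> f' (p - q)) (at_right 0)"
proof -
  have "f' (p - q) = f' (p - x) - f' (q - x)"
    using f by (simp add: has_derivative_linear linear_diff)
  with tendsto_diff[OF has_derivative_ray_tendsto[OF f S(1-3)] has_derivative_ray_tendsto[OF f S(1,2,4)]]
  show ?thesis
    by (simp flip: scaleR_diff_right)
qed

lemma eventually_ray_in_convex:
  fixes S :: "'a::real_normed_vector set"
  assumes S: "convex S" "x \<in> S" "y \<in> S"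
  shows "\<forall>\<^sub>F t in at_right 0. x + t *\<^sub>R (y - x) \<in> S"
  using convexD_alt[OF S]
  by (intro eventually_at_rightI[of 0 1]) (auto simp: algebra_simps)

text \<open>Both values are the limit of the same difference quotient along the ray from
  \<open>x\<close> to \<open>y\<close>.\<close>

lemma has_derivative_within_convex_unique_on:
  fixes f :: "'a::real_normed_vector \<Rightarrow> 'b::real_normed_vector"
  assumes "(f has_derivative f') (at x within S)" "(f has_derivative g') (at x within S)"
    and "convex S" "x \<in> S" "y \<in> S"
  shows "f' (y - x) = g' (y - x)"
  using has_derivative_ray_tendsto[OF assms(1,3,4,5)] has_derivative_ray_tendsto[OF assms(2,3,4,5)]
  by (rule tendsto_unique[rotated]) simp

text \<open>A ball inside \<open>S\<close> has room for a short step in every direction. By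
  linearity, what is known of a derivative on differences of points of \<open>S\<close> then extends
  to all vectors.\<close>

lemma interior_direction:
  fixes h :: "'a::real_normed_vector"
  assumes "interior S \<noteq> {}"
  obtains p q s where "p \<in> S" "q \<in> S" "s > 0" "s *\<^sub>R h = p - q"
proof -
  from assms obtain q e where e: "e > 0" "ball q e \<subseteq> S"
    by (auto simp: mem_interior)
  \<comment> \<open>The \<open>+ 1\<close> keeps \<open>s\<close> positive and well defined at
    \<open>h = 0\<close>.\<close>
  define s where "s = e / (2 * (norm h + 1))"
  have "s > 0" using e by (simp add: s_def add_nonneg_pos)
  have "norm h < 2 * (norm h + 1)"
    using norm_ge_zero[of h] by (smt (verit))
  from mult_strict_left_mono[OF this e(1)] have "e * norm h < e * (2 * (norm h + 1))" .
  then have "s * norm h < e"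
    by (simp add: s_def pos_divide_less_eq add_nonneg_pos)
  then have "q + s *\<^sub>R h \<in> ball q e"
    using \<open>s > 0\<close> by (simp add: dist_norm)
  with e have "q + s *\<^sub>R h \<in> S" "q \<in> S"
    using centre_in_ball by blast+
  then show ?thesis
    using that \<open>s > 0\<close> by simp
qed

text \<open>Up to a positive factor, \<open>h\<close> is \<open>(p - x) - (q - x)\<close>, and the
  two derivatives agree on each of these ray directions.\<close>

lemma has_derivative_within_convex_unique:
  fixes f :: "'a::real_normed_vector \<Rightarrow> 'b::real_normed_vector"
  assumes d: "(f has_derivative f') (at x within S)" "(f has_derivative g') (at x within S)"
    and S: "convex S" "x \<in> S" "interior S \<noteq> {}"
  shows "f' = g'"
proof
  fix h
  obtain p q s where pq: "p \<in> S" "q \<in> S" "s > 0" "s *\<^sub>R h = p - q"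
    using interior_direction[OF S(3)] by metis
  have l: "linear f'" "linear g'"
    using d by (simp_all add: has_derivative_linear)
  have "s *\<^sub>R f' h = f' (p - x) - f' (q - x)" "s *\<^sub>R g' h = g' (p - x) - g' (q - x)"
    using l pq(4) by (simp_all flip: linear_diff linear_cmul)
  then have "s *\<^sub>R f' h = s *\<^sub>R g' h"
    using has_derivative_within_convex_unique_on[OF d S(1,2)] pq by simp
  then show "f' h = g' h"
    using pq(3) by simp
qed

text \<open>Monotonicity is applied to \<open>x + t (p - x)\<close> and
  \<open>x + t (q - x)\<close>, which differ by \<open>t (p - q)\<close>. Dividing by the square of
  \<open>t\<close> and letting \<open>t\<close> tend to 0 gives the bound at \<open>p - q\<close>,
  and both sides are homogeneous of degree two.\<close>

lemma strongly_monotone_derivative: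
  fixes f :: "'a::real_inner \<Rightarrow> 'a"
  assumes f: "(f has_derivative f') (at x within S)"
    and S: "convex S" "x \<in> S" "interior S \<noteq> {}"
    and mono: "\<And>y z. y \<in> S \<Longrightarrow> z \<in> S \<Longrightarrow> (f y - f z) \<bullet> (y - z) \<ge> c * (norm (y - z))\<^sup>2"
  shows "f' h \<bullet> h \<ge> c * (norm h)\<^sup>2"
proof -
  obtain p q s where pq: "p \<in> S" "q \<in> S" "s > 0" "s *\<^sub>R h = p - q"
    using interior_direction[OF S(3)] by metis
  have lim: "((\<lambda>t. ((f (x + t *\<^sub>R (p - x)) - f (x + t *\<^sub>R (q - x))) /\<^sub>R t) \<bullet> (p - q))
      \<longlongrightarrow> f' (p - q) \<bullet> (p - q)) (at_right 0)"
    by (intro tendsto_inner tendsto_const has_derivative_chord_tendsto[OF f S(1,2) pq(1,2)])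
  have "\<forall>\<^sub>F t in at_right 0. c * (norm (p - q))\<^sup>2
      \<le> ((f (x + t *\<^sub>R (p - x)) - f (x + t *\<^sub>R (q - x))) /\<^sub>R t) \<bullet> (p - q)"
    using eventually_ray_in_convex[OF S(1,2) pq(1)] eventually_ray_in_convex[OF S(1,2) pq(2)]
      eventually_at_right_less
  proof eventually_elim
    case (elim t)
    have "(x + t *\<^sub>R (p - x)) - (x + t *\<^sub>R (q - x)) = t *\<^sub>R (p - q)"
      by (simp add: algebra_simps)
    then have "t * (t * (c * (norm (p - q))\<^sup>2))
        \<le> t * ((f (x + t *\<^sub>R (p - x)) - f (x + t *\<^sub>R (q - x))) \<bullet> (p - q))"
      using mono[OF elim(1,2)] elim(3) by (simp add: power2_eq_square ac_simps)
    then have "t * (c * (norm (p - q))\<^sup>2)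
        \<le> (f (x + t *\<^sub>R (p - x)) - f (x + t *\<^sub>R (q - x))) \<bullet> (p - q)"
      using elim(3) by (simp only: mult_le_cancel_left_pos)
    then show ?case
      using elim(3) by (simp only: inner_scaleR_left) (simp add: pos_le_divide_eq ac_simps
          flip: divide_inverse_commute)
  qed
  then have "c * (norm (p - q))\<^sup>2 \<le> f' (p - q) \<bullet> (p - q)"
    using lim by (intro tendsto_lowerbound) auto
  moreover have "f' (p - q) = s *\<^sub>R f' h"
    using f by (simp add: has_derivative_linear linear_cmul flip: pq(4))
  ultimately show ?thesis
    using pq(3) by (simp add: power_mult_distrib power2_eq_square ac_simps flip: pq(4))
qed

text \<open>The same chord argument, now homogeneous of degree one.\<close>

lemma lipschitz_derivative:
  fixes f :: "'a::real_normed_vector \<Rightarrow> 'b::real_normed_vector"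
  assumes f: "(f has_derivative f') (at x within S)"
    and S: "convex S" "x \<in> S" "interior S \<noteq> {}"
    and lip: "\<And>y z. y \<in> S \<Longrightarrow> z \<in> S \<Longrightarrow> norm (f y - f z) \<le> c * norm (y - z)"
  shows "norm (f' h) \<le> c * norm h"
proof -
  obtain p q s where pq: "p \<in> S" "q \<in> S" "s > 0" "s *\<^sub>R h = p - q"
    using interior_direction[OF S(3)] by metis
  have lim: "((\<lambda>t. norm ((f (x + t *\<^sub>R (p - x)) - f (x + t *\<^sub>R (q - x))) /\<^sub>R t))
      \<longlongrightarrow> norm (f' (p - q))) (at_right 0)"
    by (intro tendsto_norm has_derivative_chord_tendsto[OF f S(1,2) pq(1,2)])
  have "\<forall>\<^sub>F t in at_right 0. norm ((f (x + t *\<^sub>R (p - x)) - f (x + t *\<^sub>R (q - x))) /\<^sub>R t)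
      \<le> c * norm (p - q)"
    using eventually_ray_in_convex[OF S(1,2) pq(1)] eventually_ray_in_convex[OF S(1,2) pq(2)]
      eventually_at_right_less
  proof eventually_elim
    case (elim t)
    have "(x + t *\<^sub>R (p - x)) - (x + t *\<^sub>R (q - x)) = t *\<^sub>R (p - q)"
      by (simp add: algebra_simps)
    then have "norm (f (x + t *\<^sub>R (p - x)) - f (x + t *\<^sub>R (q - x))) \<le> t * (c * norm (p - q))"
      using lip[OF elim(1,2)] elim(3) by (simp add: ac_simps)
    then show ?case
      using elim(3) by (simp only: norm_scaleR abs_inverse) (simp add: pos_divide_le_eq ac_simps
          flip: divide_inverse_commute)
  qed
  then have "norm (f' (p - q)) \<le> c * norm (p - q)"
    using lim by (intro tendsto_upperbound) auto
  moreover have "f' (p - q) = s *\<^sub>R f' h"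
    using f by (simp add: has_derivative_linear linear_cmul flip: pq(4))
  ultimately show ?thesis
    using pq(3) by (simp add: ac_simps flip: pq(4))
qed

text \<open>The functional is represented by the vector \<open>adjoint f' 1\<close>, and uniqueness
  of the derivative makes the definite description in \<open>grad_within\<close> meaningful.\<close>

lemma has_derivative_grad_within:
  fixes f :: "'a::euclidean_space \<Rightarrow> real"
  assumes f: "f differentiable (at x within S)"
    and S: "convex S" "x \<in> S" "interior S \<noteq> {}"
  shows "(f has_derivative (\<lambda>h. grad_within S f x \<bullet> h)) (at x within S)"
  unfolding grad_within_def
proof (rule theI')
  from f obtain f' where f': "(f has_derivative f') (at x within S)"
    by (auto simp: differentiable_def)
  define g where "g = adjoint f' 1"
  have "f' h = g \<bullet> h" for h
    using adjoint_works[OF has_derivative_linear[OF f'], of h 1]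
    by (simp add: g_def inner_commute)
  then have "(f has_derivative (\<lambda>h. g \<bullet> h)) (at x within S)"
    using f' by (simp add: fun_eq_iff has_derivative_eq_rhs)
  then show "\<exists>!g. (f has_derivative (\<lambda>h. g \<bullet> h)) (at x within S)"
  proof (rule ex1I)
    fix g' assume "(f has_derivative (\<lambda>h. g' \<bullet> h)) (at x within S)"
    from has_derivative_within_convex_unique[OF this \<open>(f has_derivative (\<lambda>h. g \<bullet> h)) _\<close> S]
    show "g' = g"
      by (metis inner_commute vector_eq_rdot)
  qed
qed

text \<open>\<open>jacobian\<close> is built from a chosen derivative; uniqueness identifies the
  choice with \<open>f'\<close>.\<close>

lemma jacobian_within_eqI:
  fixes f :: "real^'n \<Rightarrow> real^'m"
  assumes "(f has_derivative f') (at x within S)" "convex S" "x \<in> S" "interior S \<noteq> {}"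
  shows "jacobian f (at x within S) *v h = f' h"
proof -
  have "(f has_derivative (\<lambda>h. jacobian f (at x within S) *v h)) (at x within S)"
    using assms(1) jacobian_works differentiable_def by blast
  from has_derivative_within_convex_unique[OF this assms] show ?thesis
    by (rule fun_cong)
qed

subsection \<open>Coercive matrices\<close>

text \<open>Coercivity forces a trivial kernel, hence invertibility of the square matrix. For
  \<open>y = matrix_inv A *v x\<close>, coercivity and Cauchy-Schwarz give
  \<open>c |y|^2 \<le> x \<bullet> y \<le> |x| |y|\<close>.\<close>

lemma
  fixes A :: "real^'n^'n"
  assumes A: "\<And>x. (A *v x) \<bullet> x \<ge> c * (norm x)\<^sup>2" and "c > 0"
  shows coercive_matrix_inv_right: "A *v (matrix_inv A *v x) = x" (is ?right)
    and coercive_matrix_inv_left: "matrix_inv A *v (A *v x) = x" (is ?left)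
    and coercive_matrix_inv_norm: "norm (matrix_inv A *v x) \<le> norm x / c" (is ?norm)
proof -
  have "x = 0" if "A *v x = 0" for x
    using A[of x] that \<open>c > 0\<close> by (simp add: mult_le_0_iff)
  then have "invertible A"
    by (simp add: invertible_left_inverse matrix_left_invertible_ker)
  then have "A ** matrix_inv A = mat 1 \<and> matrix_inv A ** A = mat 1"
    unfolding invertible_def matrix_inv_def by (rule someI_ex)
  then show right: ?right and ?left
    by (simp_all add: matrix_vector_mul_assoc)
  let ?y = "matrix_inv A *v x"
  have "c * (norm ?y)\<^sup>2 \<le> x \<bullet> ?y"
    using A[of ?y] right by simp
  also have "\<dots> \<le> norm x * norm ?y"
    by (rule norm_cauchy_schwarz)
  finally show ?norm
    using \<open>c > 0\<close> by (cases "norm ?y = 0") (auto simp: field_simps power2_eq_square)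
qed

text \<open>The subtracted product has norm at most \<open>b * (1 / \<alpha>) * a\<close>, the
  middle factor bounding the inverse of \<open>A\<close>; this much is lost from the coercivity of
  \<open>D\<close>.\<close>

lemma coercive_schur_complement:
  fixes A :: "real^'n^'n" and B :: "real^'m^'n" and C :: "real^'n^'m" and D :: "real^'m^'m"
  assumes A: "\<And>x. (A *v x) \<bullet> x \<ge> \<alpha> * (norm x)\<^sup>2" and "\<alpha> > 0"
    and B: "\<And>x. norm (B *v x) \<le> a * norm x" and C: "\<And>x. norm (C *v x) \<le> b * norm x"
    and D: "\<And>x. (D *v x) \<bullet> x \<ge> \<delta> * (norm x)\<^sup>2" and "b \<ge> 0"
  shows "((D - C ** matrix_inv A ** B) *v x) \<bullet> x \<ge> (\<delta> - a * b / \<alpha>) * (norm x)\<^sup>2"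
proof -
  let ?w = "C *v (matrix_inv A *v (B *v x))"
  have "norm ?w \<le> b * (norm (B *v x) / \<alpha>)"
    using C coercive_matrix_inv_norm[OF A \<open>\<alpha> > 0\<close>] \<open>b \<ge> 0\<close> by (meson mult_left_mono order_trans)
  also have "\<dots> \<le> b * (a * norm x / \<alpha>)"
    using B \<open>b \<ge> 0\<close> \<open>\<alpha> > 0\<close> by (intro mult_left_mono divide_right_mono) auto
  finally have "norm ?w * norm x \<le> a * b / \<alpha> * norm x * norm x"
    by (intro mult_right_mono) (auto simp: ac_simps)
  then have "?w \<bullet> x \<le> a * b / \<alpha> * (norm x)\<^sup>2"
    using norm_cauchy_schwarz[of ?w x] by (simp add: power2_eq_square)
  then show ?thesis
    using D[of x]
    by (simp add: matrix_vector_mult_diff_rdistrib inner_diff_left left_diff_distrib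
        flip: matrix_vector_mul_assoc)
qed

text \<open>A least element of the set of eigenvalues has to be exhibited. The minimiser
  \<open>v\<close> of the quadratic form on the unit sphere supplies it: varying \<open>v\<close>
  along its residual \<open>w\<close> shows that \<open>v\<close> is an eigenvector.\<close>

lemma min_eigenvalue_symmetric:
  fixes A :: "real^'n^'n"
  assumes sym: "\<And>x y. (A *v x) \<bullet> y = x \<bullet> (A *v y)"
  obtains v where "norm v = 1" "A *v v = min_eigenvalue A *\<^sub>R v"
    and "\<And>x. (A *v x) \<bullet> x \<ge> min_eigenvalue A * (norm x)\<^sup>2"
proof -
  have "compact (sphere (0::real^'n) 1)" "sphere (0::real^'n) 1 \<noteq> {}"
    using norm_axis_1 by (auto intro!: exI[of _ "axis undefined 1"])
  moreover have "continuous_on (sphere 0 1) (\<lambda>x. (A *v x) \<bullet> x)"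
    by (intro continuous_on_inner linear_continuous_on matrix_vector_mul_bounded_linear
        continuous_on_id)
  ultimately obtain v where v: "norm v = 1"
    and min: "\<And>x. norm x = 1 \<Longrightarrow> (A *v v) \<bullet> v \<le> (A *v x) \<bullet> x"
    using continuous_attains_inf[of "sphere (0::real^'n) 1" "\<lambda>x. (A *v x) \<bullet> x"] by auto
  define \<mu> where "\<mu> = (A *v v) \<bullet> v"
  have bound: "(A *v x) \<bullet> x \<ge> \<mu> * (norm x)\<^sup>2" for x
  proof (cases "x = 0")
    case False
    with min[of "x /\<^sub>R norm x"] show ?thesis
      by (simp add: \<mu>_def matrix_vector_mult_scaleR field_simps power2_eq_square)
  qed simp
  define w where "w = A *v v - \<mu> *\<^sub>R v"
  define k where "k = (A *v w) \<bullet> w - \<mu> * (norm w)\<^sup>2"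
  have vv: "v \<bullet> v = 1"
    using v by (simp add: norm_eq_1)
  \<comment> \<open>The form \<open>(A *v x) \<bullet> x - \<mu> |x|^2\<close> is nonnegative and
    vanishes at \<open>v\<close>; at \<open>v - t w\<close> it equals
    \<open>t (t k - 2 |w|^2)\<close>.\<close>
  have "t * k \<ge> 2 * (norm w)\<^sup>2" if "t > 0" for t :: real
  proof -
    have N: "(norm (v - t *\<^sub>R w))\<^sup>2 = v \<bullet> v - 2 * t * (v \<bullet> w) + t\<^sup>2 * (norm w)\<^sup>2"
      unfolding power2_norm_eq_inner
      by (simp add: inner_diff_left inner_diff_right inner_commute[of w v] algebra_simps
          power2_eq_square)
    have "(A *v (v - t *\<^sub>R w)) \<bullet> (v - t *\<^sub>R w) - \<mu> * (norm (v - t *\<^sub>R w))\<^sup>2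
        = ((A *v v) \<bullet> v - \<mu> * (v \<bullet> v)) - 2 * t * ((A *v v - \<mu> *\<^sub>R v) \<bullet> w) + t\<^sup>2 * k"
      using sym[of w v] unfolding N
      by (simp add: k_def matrix_vector_mult_diff_distrib inner_commute
          matrix_vector_mult_scaleR inner_diff_left inner_diff_right algebra_simps power2_eq_square)
    also have "\<dots> = t * (t * k - 2 * (norm w)\<^sup>2)"
      unfolding w_def[symmetric]
      by (simp add: \<mu>_def vv dot_square_norm[of w] algebra_simps power2_eq_square)
    finally have "0 \<le> t * (t * k - 2 * (norm w)\<^sup>2)"
      using bound[of "v - t *\<^sub>R w"] by linarith
    then show ?thesis
      using that by (simp add: zero_le_mult_iff)
  qed
  note * = this
  \<comment> \<open>For positive \<open>k\<close>, the choice \<open>t = |w|^2 / k\<close> yields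
    \<open>|w|^2 \<ge> 2 |w|^2\<close>.\<close>
  have "(norm w)\<^sup>2 \<le> 0"
  proof (cases "k \<le> 0")
    case True
    then show ?thesis using *[of 1] zero_le_power2[of "norm w"] by linarith
  next
    case False
    then show ?thesis
      using *[of "(norm w)\<^sup>2 / k"] by (cases "w = 0") simp_all
  qed
  then have eig: "A *v v = \<mu> *\<^sub>R v"
    by (simp add: w_def)
  have "min_eigenvalue A = \<mu>"
    unfolding min_eigenvalue_def
  proof (rule Least_equality)
    show "\<exists>v. v \<noteq> 0 \<and> A *v v = \<mu> *\<^sub>R v"
      using eig v by (metis norm_zero zero_neq_one)
  next
    fix c assume "\<exists>v. v \<noteq> 0 \<and> A *v v = c *\<^sub>R v"
    then obtain x where "x \<noteq> 0" "A *v x = c *\<^sub>R x" by auto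
    with bound[of x] show "\<mu> \<le> c"
      by (simp flip: power2_norm_eq_inner)
  qed
  with that v eig bound show ?thesis by metis
qed

lemma inner_transpose_matrix_vector:
  fixes A :: "real^'n^'m"
  shows "(transpose A *v x) \<bullet> y = x \<bullet> (A *v y)"
  by (simp add: dot_lmul_matrix)

text \<open>A matrix and its symmetric part have the same quadratic form, which gives the bound. For
  positivity, \<open>m\<close> is the value of that form at a unit eigenvector \<open>v\<close>, and
  with \<open>u = matrix_inv A *v v\<close> this value is
  \<open>(A *v u) \<bullet> u > 0\<close>.\<close>

lemma
  fixes A :: "real^'n^'n"
  assumes A: "\<And>x. (A *v x) \<bullet> x \<ge> c * (norm x)\<^sup>2" and "c > 0"
  defines "m \<equiv> min_eigenvalue ((1/2) *\<^sub>R (matrix_inv A + transpose (matrix_inv A)))"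
  shows coercive_min_eigenvalue_inv_pos: "m > 0"
    and coercive_min_eigenvalue_inv_bound: "(matrix_inv A *v x) \<bullet> x \<ge> m * (norm x)\<^sup>2"
proof -
  define S where "S = matrix_inv A"
  define B where "B = (1/2) *\<^sub>R (S + transpose S)"
  have Bx: "B *v x = (1/2) *\<^sub>R (S *v x + transpose S *v x)" for x
    by (simp add: B_def scaleR_matrix_vector_assoc[symmetric] matrix_vector_mult_add_rdistrib)
  have transpose: "(transpose S *v x) \<bullet> y = x \<bullet> (S *v y)" "(S *v x) \<bullet> y = x \<bullet> (transpose S *v y)" for x y
    by (metis inner_transpose_matrix_vector transpose_transpose)+
  have BS: "(B *v x) \<bullet> x = (S *v x) \<bullet> x" for x
    unfolding Bx inner_scaleR_left inner_add_left transpose(1) inner_commute[of x] by simp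
  have "(B *v x) \<bullet> y = x \<bullet> (B *v y)" for x y
    unfolding Bx inner_scaleR_left inner_scaleR_right inner_add_left inner_add_right transpose
    by (simp only: add.commute)
  from min_eigenvalue_symmetric[OF this] obtain v where v: "norm v = 1" "B *v v = m *\<^sub>R v"
    and bound: "\<And>x. (B *v x) \<bullet> x \<ge> m * (norm x)\<^sup>2"
    unfolding m_def B_def S_def by metis
  show "(matrix_inv A *v x) \<bullet> x \<ge> m * (norm x)\<^sup>2"
    using bound[of x] unfolding BS by (simp add: S_def)
  have "A *v (S *v v) = v"
    unfolding S_def by (rule coercive_matrix_inv_right[OF A \<open>c > 0\<close>])
  then have "S *v v \<noteq> 0" "c * (norm (S *v v))\<^sup>2 \<le> v \<bullet> (S *v v)"
    using v(1) A[of "S *v v"] by auto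
  moreover from this \<open>c > 0\<close> have "0 < c * (norm (S *v v))\<^sup>2"
    by simp
  ultimately have "0 < (S *v v) \<bullet> v"
    unfolding inner_commute[of _ v] by linarith
  also have "\<dots> = m"
    using v BS[of v] by (simp add: dot_square_norm)
  finally show "m > 0" .
qed

text \<open>Here \<open>w\<close> stands for \<open>Sq *v v\<close>; it enters only through its
  component along \<open>v\<close> and its norm.\<close>

lemma sgn_inner_pos_of_cosine:
  fixes g v w :: "'a::real_inner"
  assumes "g \<noteq> 0" "v \<noteq> 0" and "m > 0" "\<tau> > 0"
    and lower: "w \<bullet> v \<ge> m * (norm v)\<^sup>2" and upper: "norm w \<le> norm v / \<tau>"
    and cos: "\<bar>cosine g v\<bar> > 1 / sqrt (1 + m\<^sup>2 * \<tau>\<^sup>2)"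
  shows "sgn (cosine g v) * (g \<bullet> w) > 0"
proof -
  define \<rho> where "\<rho> = cosine g v"
  \<comment> \<open>\<open>a\<close> equals \<open>g \<bullet> v / |v|^2\<close>, so
    \<open>a v\<close> is the orthogonal projection of \<open>g\<close> onto \<open>v\<close> and
    \<open>e\<close> the transverse part.\<close>
  define a where "a = norm g / norm v * \<rho>"
  define e where "e = g - a *\<^sub>R v"
  have nz: "norm g > 0" "norm v > 0" using assms by auto
  have gv: "g \<bullet> v = \<rho> * norm g * norm v"
    using nz by (simp add: \<rho>_def cosine_def)
  have av: "a * norm v = \<rho> * norm g" using nz by (simp add: a_def)
  have "(norm e)\<^sup>2 = g \<bullet> g - 2 * a * (g \<bullet> v) + a\<^sup>2 * (v \<bullet> v)"
    unfolding e_def power2_norm_eq_inner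
    by (simp add: inner_diff_left inner_diff_right inner_commute[of v g] algebra_simps
        power2_eq_square)
  then have "(norm e)\<^sup>2 = (norm g)\<^sup>2 - 2 * (a * norm v) * (\<rho> * norm g) + (a * norm v)\<^sup>2"
    by (simp add: gv power_mult_distrib flip: power2_norm_eq_inner)
  then have e2: "(norm e)\<^sup>2 = (norm g)\<^sup>2 * (1 - \<rho>\<^sup>2)"
    unfolding av by (simp add: power2_eq_square algebra_simps)
  have pos: "1 + m\<^sup>2 * \<tau>\<^sup>2 > 0"
    by (simp add: add_pos_nonneg)
  \<comment> \<open>Squaring turns the cosine condition into
    \<open>1 - \<rho>^2 < (\<bar>\<rho>\<bar> m \<tau>)^2\<close>, a bound on the transverse part of
    \<open>g\<close> by the parallel one.\<close>
  have "1 < \<bar>\<rho>\<bar> * sqrt (1 + m\<^sup>2 * \<tau>\<^sup>2)"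
    using cos pos by (simp add: \<rho>_def field_simps)
  then have "1\<^sup>2 < (\<bar>\<rho>\<bar> * sqrt (1 + m\<^sup>2 * \<tau>\<^sup>2))\<^sup>2"
    by (intro power_strict_mono) auto
  then have "1 - \<rho>\<^sup>2 < (\<bar>\<rho>\<bar> * m * \<tau>)\<^sup>2"
    using pos by (simp add: power_mult_distrib algebra_simps)
  then have "(norm e)\<^sup>2 < (norm g * (\<bar>\<rho>\<bar> * m * \<tau>))\<^sup>2"
    using nz by (simp add: e2 power_mult_distrib[of "norm g"])
  then have "norm e < norm g * (\<bar>\<rho>\<bar> * m * \<tau>)"
    by (rule power2_less_imp_less) (use \<open>m > 0\<close> \<open>\<tau> > 0\<close> in simp)
  then have "norm e * (norm v / \<tau>) < norm g * (\<bar>\<rho>\<bar> * m * \<tau>) * (norm v / \<tau>)"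
    by (rule mult_strict_right_mono) (use nz \<open>\<tau> > 0\<close> in simp)
  also have "norm g * (\<bar>\<rho>\<bar> * m * \<tau>) * (norm v / \<tau>) = \<bar>\<rho>\<bar> * norm g / norm v * (m * (norm v)\<^sup>2)"
    using nz \<open>\<tau> > 0\<close> by (simp add: power2_eq_square)
  finally have e_small: "norm e * norm w < \<bar>\<rho>\<bar> * norm g / norm v * (m * (norm v)\<^sup>2)"
    using mult_left_mono[OF upper norm_ge_zero[of e]] by (rule le_less_trans[rotated])
  have "sgn \<rho> * a = \<bar>\<rho>\<bar> * norm g / norm v"
    by (simp add: a_def abs_sgn ac_simps)
  moreover have "g \<bullet> w = a * (w \<bullet> v) + e \<bullet> w"
    unfolding e_def by (simp add: inner_diff_left inner_commute[of w v])
  ultimately have "sgn \<rho> * (g \<bullet> w) = \<bar>\<rho>\<bar> * norm g / norm v * (w \<bullet> v) + sgn \<rho> * (e \<bullet> w)"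
    by (simp only: distrib_left mult.assoc[symmetric])
  moreover have "\<bar>sgn \<rho> * (e \<bullet> w)\<bar> \<le> norm e * norm w"
    using Cauchy_Schwarz_ineq2[of e w] by (simp add: abs_mult abs_sgn_eq)
  moreover have "\<bar>\<rho>\<bar> * norm g / norm v * (m * (norm v)\<^sup>2) \<le> \<bar>\<rho>\<bar> * norm g / norm v * (w \<bullet> v)"
    using lower nz by (intro mult_left_mono) auto
  ultimately show ?thesis
    using e_small unfolding \<rho>_def[symmetric] by linarith
qed

text \<open>Block elimination: the first equation is solved for \<open>a\<close> and inserted into
  the second.\<close>

lemma schur_complement_solve:
  fixes A :: "real^'n^'n" and B :: "real^'m^'n" and C :: "real^'n^'m" and D :: "real^'m^'m"
  assumes A: "\<And>x. (A *v x) \<bullet> x \<ge> \<alpha> * (norm x)\<^sup>2" "\<alpha> > 0"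
    and eqs: "A *v a + B *v b = y" "C *v a + D *v b = 0"
  shows "(D - C ** matrix_inv A ** B) *v b = - (C *v (matrix_inv A *v y))"
proof -
  have "matrix_inv A *v y = a + matrix_inv A *v (B *v b)"
    unfolding eqs(1)[symmetric] by (simp add: matrix_vector_right_distrib coercive_matrix_inv_left[OF A])
  with eqs(2) show ?thesis
    by (simp add: matrix_vector_mult_diff_rdistrib matrix_vector_right_distrib add_eq_0_iff
        flip: matrix_vector_mul_assoc)
qed

text \<open>With denominators cleared, the sum condition is
  \<open>(\<gamma>\<theta> - a) * (\<gamma>\<phi> - b) > a * b\<close>.\<close>

lemma contraction_constants:
  fixes \<gamma>\<theta> \<gamma>\<phi> a b :: real
  assumes "\<gamma>\<theta> > 0" "\<gamma>\<phi> > 0" "a \<ge> 0" "b \<ge> 0" and sum: "a / \<gamma>\<theta> + b / \<gamma>\<phi> < 1"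
  shows "a < \<gamma>\<theta>" "\<gamma>\<phi> - b - a * b / (\<gamma>\<theta> - a) > 0"
proof -
  from sum have *: "a * \<gamma>\<phi> + b * \<gamma>\<theta> < \<gamma>\<theta> * \<gamma>\<phi>"
    using assms by (simp add: field_simps)
  have "a / \<gamma>\<theta> < 1"
    using sum assms by (smt (verit) divide_nonneg_pos)
  then show "a < \<gamma>\<theta>"
    using assms by simp
  moreover have "(\<gamma>\<theta> - a) * (\<gamma>\<phi> - b) > a * b"
    using * by (simp add: algebra_simps)
  ultimately show "\<gamma>\<phi> - b - a * b / (\<gamma>\<theta> - a) > 0"
    by (simp add: pos_divide_less_eq mult.commute)
qed

subsection \<open>Mean gradients\<close>

text \<open>An interior point provides two distinct points of \<open>T\<close>, and smoothness
  between them bounds a norm by \<open>L\<close> times a positive number.\<close>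

lemma smooth_loss_nonneg:
  fixes l :: "'a::euclidean_space \<Rightarrow> 'z::real_normed_vector \<Rightarrow> real"
  assumes "smooth_loss L T l" "interior T \<noteq> {}"
  shows "L \<ge> 0"
proof -
  obtain h :: 'a where "norm h = 1"
    using norm_Basis nonempty_Basis by blast
  moreover obtain p q s where "p \<in> T" "q \<in> T" "s > 0" "s *\<^sub>R h = p - q"
    using interior_direction[OF assms(2)] by metis
  ultimately have "p \<in> T" "q \<in> T" "norm (p - q) > 0"
    by (metis norm_eq_zero norm_scaleR mult_eq_0_iff zero_less_norm_iff zero_neq_one abs_0_eq less_irrefl)+
  moreover from this have "norm (loss_grad T l p z - loss_grad T l q z) \<le> L * norm (p - q)" for z
    using assms(1) by (simp add: smooth_loss_def)
  ultimately show ?thesis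
    by (meson norm_ge_zero order_trans zero_le_mult_iff not_less)
qed

text \<open>The strong convexity inequalities from \<open>s\<close> to \<open>t\<close> and from
  \<open>t\<close> to \<open>s\<close> are added.\<close>

lemma loss_grad_strongly_monotone:
  assumes "strongly_convex_loss \<gamma> T l" "t \<in> T" "s \<in> T"
  shows "(loss_grad T l t z - loss_grad T l s z) \<bullet> (t - s) \<ge> \<gamma> * (norm (t - s))\<^sup>2"
proof -
  have "l t z \<ge> l s z + loss_grad T l s z \<bullet> (t - s) + \<gamma> / 2 * (norm (t - s))\<^sup>2"
    "l s z \<ge> l t z + loss_grad T l t z \<bullet> (s - t) + \<gamma> / 2 * (norm (s - t))\<^sup>2"
    using assms by (auto simp: strongly_convex_loss_def)
  moreover have "loss_grad T l t z \<bullet> (s - t) = - (loss_grad T l t z \<bullet> (t - s))"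
    by (simp add: inner_diff_right)
  ultimately show ?thesis
    by (simp add: inner_diff_left norm_minus_commute[of s t])
qed

text \<open>The results on mean gradients put a model's own parameter first, whereas
  \<open>Q\<close> takes that of model \<open>\<phi>\<close> second.\<close>

lemma sensitive_swap:
  assumes "sensitive \<epsilon> T U D"
  shows "sensitive \<epsilon> U T (\<lambda>u t. D t u)"
proof -
  have "norm ((u, t) - (u', t')) = norm ((t, u) - (t', u'))"
    for t t' :: 'a and u u' :: 'b
    by (simp add: norm_Pair add.commute)
  with assms show ?thesis
    by (auto simp: sensitive_def)
qed

text \<open>A change of the own parameter moves both integrand and distribution: the first
  contributes \<open>\<gamma>\<close> by strong monotonicity, the second costs at most
  \<open>L * \<epsilon>\<close> by the Wasserstein estimate. A change of the other parameter moves
  the distribution only.\<close>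

lemma
  fixes T :: "'a::euclidean_space set" and U :: "'b::real_normed_vector set"
    and l :: "'a \<Rightarrow> 'z::{real_normed_vector, second_countable_topology} \<Rightarrow> real"
    and D :: "'a \<Rightarrow> 'b \<Rightarrow> 'z measure"
  assumes prob: "\<And>t u. t \<in> T \<Longrightarrow> u \<in> U \<Longrightarrow> D t u \<in> space (prob_algebra borel)"
    and int: "\<And>s t u. s \<in> T \<Longrightarrow> t \<in> T \<Longrightarrow> u \<in> U \<Longrightarrow> integrable (D t u) (loss_grad T l s)"
    and smooth: "smooth_loss L T l" "L \<ge> 0"
    and sens: "sensitive \<epsilon> T U D"
  shows mean_grad_lipschitz: "\<And>t u u'. t \<in> T \<Longrightarrow> u \<in> U \<Longrightarrow> u' \<in> U \<Longrightarrow>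
      norm ((LINT z|D t u. loss_grad T l t z) - (LINT z|D t u'. loss_grad T l t z))
        \<le> L * \<epsilon> * norm (u - u')"
    and mean_grad_strongly_monotone: "\<And>t s u. strongly_convex_loss \<gamma> T l \<Longrightarrow>
      t \<in> T \<Longrightarrow> s \<in> T \<Longrightarrow> u \<in> U \<Longrightarrow>
      ((LINT z|D t u. loss_grad T l t z) - (LINT z|D s u. loss_grad T l s z)) \<bullet> (t - s)
        \<ge> (\<gamma> - L * \<epsilon>) * (norm (t - s))\<^sup>2"
proof -
  have shift: "norm ((LINT z|D t u. loss_grad T l s z) - (LINT z|D t' u'. loss_grad T l s z))
        \<le> L * (\<epsilon> * norm ((t, u) - (t', u')))"
    if "s \<in> T" "t \<in> T" "u \<in> U" "t' \<in> T" "u' \<in> U" for s t u t' u'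
    using that sens smooth prob int
    by (intro norm_integral_diff_le_wasserstein1)
      (auto simp: sensitive_def smooth_loss_def space_prob_algebra dist_norm)
  show "norm ((LINT z|D t u. loss_grad T l t z) - (LINT z|D t u'. loss_grad T l t z))
      \<le> L * \<epsilon> * norm (u - u')" if "t \<in> T" "u \<in> U" "u' \<in> U" for t u u'
    using shift[OF that(1,1,2,1,3)] by (simp add: norm_Pair ac_simps)
  show "((LINT z|D t u. loss_grad T l t z) - (LINT z|D s u. loss_grad T l s z)) \<bullet> (t - s)
      \<ge> (\<gamma> - L * \<epsilon>) * (norm (t - s))\<^sup>2"
    if conv: "strongly_convex_loss \<gamma> T l" and mem: "t \<in> T" "s \<in> T" "u \<in> U" for t s u
  proof -
    interpret prob_space "D t u"
      using prob[OF mem(1,3)] by (simp add: space_prob_algebra)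
    let ?d = "(LINT z|D t u. loss_grad T l s z) - (LINT z|D s u. loss_grad T l s z)"
    have "\<gamma> * (norm (t - s))\<^sup>2 = (LINT z|D t u. \<gamma> * (norm (t - s))\<^sup>2)"
      by (simp add: prob_space)
    also have "\<dots> \<le> (LINT z|D t u. (loss_grad T l t z - loss_grad T l s z) \<bullet> (t - s))"
      using int mem loss_grad_strongly_monotone[OF conv mem(1,2)]
      by (intro integral_mono) auto
    also have "\<dots> = ((LINT z|D t u. loss_grad T l t z) - (LINT z|D t u. loss_grad T l s z)) \<bullet> (t - s)"
      using int mem by simp
    finally have 1: "\<gamma> * (norm (t - s))\<^sup>2 \<le> \<dots>" .
    have "\<bar>?d \<bullet> (t - s)\<bar> \<le> norm ?d * norm (t - s)"
      by (rule Cauchy_Schwarz_ineq2)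
    also have "\<dots> \<le> L * (\<epsilon> * norm (t - s)) * norm (t - s)"
      using shift[OF mem(2,1,3,2,3)] by (intro mult_right_mono) (auto simp: norm_Pair)
    finally have "?d \<bullet> (t - s) \<ge> - (L * \<epsilon> * (norm (t - s))\<^sup>2)"
      by (simp add: power2_eq_square ac_simps)
    with 1 show ?thesis
      by (simp add: inner_diff_left left_diff_distrib)
  qed
qed

subsection \<open>Response of the stable point\<close>

theorem corollaryE2:
  fixes \<Theta> :: "(real^'n) set" and \<Phi> :: "(real^'m) set"
    and l\<theta> :: "real^'n \<Rightarrow> 'x::{real_normed_vector, second_countable_topology}
                 \<times> 'y::{real_normed_vector, second_countable_topology} \<Rightarrow> real"
    and l\<phi> :: "real^'m \<Rightarrow> 'x \<times> 'y \<Rightarrow> real"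
    and PR QR :: "('x \<times> 'y) measure"
    and PS PH QS QH :: "real^'n \<Rightarrow> real^'m \<Rightarrow> ('x \<times> 'y) measure"
    and wR wS :: "real \<Rightarrow> real" and vR vS vH :: real
    and I :: "real set" and h0 :: real
    and \<theta>s :: "real \<Rightarrow> real^'n" and \<phi>s :: "real \<Rightarrow> real^'m"
    and q :: "real^'m \<Rightarrow> 'x \<Rightarrow> 'y measure" and r :: "real^'m \<Rightarrow> 'x \<times> 'y \<Rightarrow> real"
    and \<E> :: "'x measure"
    and \<gamma>\<theta> \<gamma>\<phi> L\<theta> L\<phi> \<epsilon>\<theta> \<epsilon>\<phi> \<kappa> \<tau>q mq \<rho>q :: real
    and P :: "real \<Rightarrow> real^'n \<Rightarrow> real^'m \<Rightarrow> ('x \<times> 'y) measure"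
    and Q :: "real^'n \<Rightarrow> real^'m \<Rightarrow> ('x \<times> 'y) measure"
    and Fp :: "real^'n \<Rightarrow> real^'m \<Rightarrow> real \<Rightarrow> real^'n"
    and Fq :: "real^'n \<Rightarrow> real^'m \<Rightarrow> real^'m"
    and Jp\<theta> :: "real^'n^'n" and Jp\<phi> :: "real^'m^'n"
    and Jq\<theta> :: "real^'n^'m" and Jq\<phi> :: "real^'m^'m"
    and Sq :: "real^'m^'m" and Cq :: "real^'n^'m"
    and Jq :: "real^'m \<Rightarrow> real" and gJ v :: "real^'m"
  \<comment> \<open>parameter sets\<close>
  assumes Theta: "closed \<Theta>" "convex \<Theta>" "interior \<Theta> \<noteq> {}"
    and Phi: "closed \<Phi>" "convex \<Phi>" "interior \<Phi> \<noteq> {}"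
  \<comment> \<open>component distributions\<close>
    and real_data: "PR \<in> space (prob_algebra borel)" "QR \<in> space (prob_algebra borel)"
    and synthetic: "\<And>t u. t \<in> \<Theta> \<Longrightarrow> u \<in> \<Phi> \<Longrightarrow> PS t u \<in> space (prob_algebra borel)"
      "\<And>t u. t \<in> \<Theta> \<Longrightarrow> u \<in> \<Phi> \<Longrightarrow> QS t u \<in> space (prob_algebra borel)"
    and curated: "\<And>t u. t \<in> \<Theta> \<Longrightarrow> u \<in> \<Phi> \<Longrightarrow> PH t u \<in> space (prob_algebra borel)"
      "\<And>t u. t \<in> \<Theta> \<Longrightarrow> u \<in> \<Phi> \<Longrightarrow> QH t u \<in> space (prob_algebra borel)"
  \<comment> \<open>the range \<open>I\<close> of curated weights of model \<open>\<theta>\<close>, around the current weight \<open>h0\<close>\<close>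
    and range: "is_interval I" "I \<subseteq> {0..<1}" "h0 \<in> I" "\<exists>h\<in>I. h \<noteq> h0"
  \<comment> \<open>mixing weights; the ratio \<open>wS : wR\<close> stays fixed\<close>
    and weights\<theta>: "\<And>h. h \<in> I \<Longrightarrow> wR h \<ge> 0 \<and> wS h \<ge> 0 \<and> wR h + wS h + h = 1"
    and ratio: "\<And>h h'. h \<in> I \<Longrightarrow> h' \<in> I \<Longrightarrow> wS h * wR h' = wS h' * wR h"
    and weights\<phi>: "vR \<ge> 0" "vS \<ge> 0" "vH \<ge> 0" "vR + vS + vH = 1"
  \<comment> \<open>training distributions\<close>
    and P: "P = (\<lambda>h t u. mixture (wR h) (wS h) h PR (PS t u) (PH t u))"
    and Q: "Q = (\<lambda>t u. mixture vR vS vH QR (QS t u) (QH t u))"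
  \<comment> \<open>the losses are differentiable in the parameter, and the expectations exist\<close>
    and diff_loss: "\<And>t z. t \<in> \<Theta> \<Longrightarrow> (\<lambda>s. l\<theta> s z) differentiable (at t within \<Theta>)"
      "\<And>u z. u \<in> \<Phi> \<Longrightarrow> (\<lambda>s. l\<phi> s z) differentiable (at u within \<Phi>)"
    and integrable\<theta>: "\<And>t t' u' M. t \<in> \<Theta> \<Longrightarrow> t' \<in> \<Theta> \<Longrightarrow> u' \<in> \<Phi> \<Longrightarrow> M \<in> {PR, PS t' u', PH t' u'} \<Longrightarrow>
        integrable M (l\<theta> t) \<and> integrable M (loss_grad \<Theta> l\<theta> t)"
    and integrable\<phi>: "\<And>u t' u' M. u \<in> \<Phi> \<Longrightarrow> t' \<in> \<Theta> \<Longrightarrow> u' \<in> \<Phi> \<Longrightarrow> M \<in> {QR, QS t' u', QH t' u'} \<Longrightarrow>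
        integrable M (l\<phi> u) \<and> integrable M (loss_grad \<Phi> l\<phi> u)"
  \<comment> \<open>mean gradients\<close>
    and Fp: "Fp = (\<lambda>t u h. LINT z|P h t u. loss_grad \<Theta> l\<theta> t z)"
    and Fq: "Fq = (\<lambda>t u. LINT z|Q t u. loss_grad \<Phi> l\<phi> u z)"
  \<comment> \<open>the stable point as a function of the curated weight\<close>
    and stable: "\<And>h. h \<in> I \<Longrightarrow> stable_point \<Theta> \<Phi> l\<theta> l\<phi> (P h) Q (\<theta>s h) (\<phi>s h)"
    and zero: "\<And>h. h \<in> I \<Longrightarrow> Fp (\<theta>s h) (\<phi>s h) h = 0 \<and> Fq (\<theta>s h) (\<phi>s h) = 0"
    and diff_stable: "\<theta>s differentiable (at h0 within I)" "\<phi>s differentiable (at h0 within I)"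
    and diff_Fp: "(\<lambda>(t, u, h). Fp t u h) differentiable
        (at (\<theta>s h0, \<phi>s h0, h0) within \<Theta> \<times> \<Phi> \<times> I)"
    and diff_Fq: "(\<lambda>(t, u). Fq t u) differentiable (at (\<theta>s h0, \<phi>s h0) within \<Theta> \<times> \<Phi>)"
  \<comment> \<open>Jacobians at the stable point, and the matrices built from them\<close>
    and Jp\<theta>: "Jp\<theta> = jacobian (\<lambda>t. Fp t (\<phi>s h0) h0) (at (\<theta>s h0) within \<Theta>)"
    and Jp\<phi>: "Jp\<phi> = jacobian (\<lambda>u. Fp (\<theta>s h0) u h0) (at (\<phi>s h0) within \<Phi>)"
    and Jq\<theta>: "Jq\<theta> = jacobian (\<lambda>t. Fq t (\<phi>s h0)) (at (\<theta>s h0) within \<Theta>)"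
    and Jq\<phi>: "Jq\<phi> = jacobian (\<lambda>u. Fq (\<theta>s h0) u) (at (\<phi>s h0) within \<Phi>)"
    and Sq: "Sq = matrix_inv (Jq\<phi> - Jq\<theta> ** matrix_inv Jp\<theta> ** Jp\<phi>)"
    and Cq: "Cq = - (Jq\<theta> ** matrix_inv Jp\<theta>)"
  \<comment> \<open>expected reward of model \<open>\<phi>\<close>\<close>
    and eval_dist: "\<E> \<in> space (prob_algebra borel)"
    and model_q: "\<And>u. u \<in> \<Phi> \<Longrightarrow> q u \<in> borel \<rightarrow>\<^sub>M prob_algebra borel"
    and integrable_r: "\<And>u. u \<in> \<Phi> \<Longrightarrow> integrable (joint_law \<E> (q u)) (r u)"
    and Jq: "Jq = (\<lambda>u. LINT z|joint_law \<E> (q u). r u z)"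
    and diff_Jq: "Jq differentiable (at (\<phi>s h0) within \<Phi>)"
    and gJ: "gJ = grad_within \<Phi> Jq (\<phi>s h0)"
    and v: "v = Cq *v (LINT z|PH (\<theta>s h0) (\<phi>s h0). - loss_grad \<Theta> l\<theta> (\<theta>s h0) z)"
    and \<rho>q: "\<rho>q = cosine gJ v"
  \<comment> \<open>hypotheses of the corollary\<close>
    and convex\<theta>: "strongly_convex_loss \<gamma>\<theta> \<Theta> l\<theta>" and smooth\<theta>: "smooth_loss L\<theta> \<Theta> l\<theta>"
    and convex\<phi>: "strongly_convex_loss \<gamma>\<phi> \<Phi> l\<phi>" and smooth\<phi>: "smooth_loss L\<phi> \<Phi> l\<phi>"
    and sensitive\<theta>: "sensitive \<epsilon>\<theta> \<Theta> \<Phi> (P h0)" and sensitive\<phi>: "sensitive \<epsilon>\<phi> \<Theta> \<Phi> Q"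
    and \<kappa>: "\<kappa> = Max {(\<gamma>\<theta> * L\<phi> * \<epsilon>\<phi> + 2 * \<gamma>\<phi> * L\<theta> * \<epsilon>\<theta>) / (\<gamma>\<phi> * (\<gamma>\<theta> - L\<theta> * \<epsilon>\<theta>)),
                     (\<gamma>\<phi> * L\<theta> * \<epsilon>\<theta> + 2 * \<gamma>\<theta> * L\<phi> * \<epsilon>\<phi>) / (\<gamma>\<theta> * (\<gamma>\<phi> - L\<phi> * \<epsilon>\<phi>)),
                     L\<theta> * \<epsilon>\<theta> / \<gamma>\<theta> + L\<phi> * \<epsilon>\<phi> / \<gamma>\<phi>}" "\<kappa> < 1"
    and \<tau>q: "\<tau>q = \<gamma>\<phi> - L\<phi> * \<epsilon>\<phi> - L\<theta> * \<epsilon>\<theta> * L\<phi> * \<epsilon>\<phi> / (\<gamma>\<theta> - L\<theta> * \<epsilon>\<theta>)"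
    and mq: "mq = min_eigenvalue ((1/2) *\<^sub>R (Sq + transpose Sq))"
  shows "onorm ((*v) Sq) \<le> 1 / \<tau>q \<and>
    (gJ \<noteq> 0 \<and> v \<noteq> 0 \<and> \<bar>\<rho>q\<bar> > 1 / sqrt (1 + mq\<^sup>2 * \<tau>q\<^sup>2) \<longrightarrow>
      (\<exists>D. ((\<lambda>h. Jq (\<phi>s h)) has_real_derivative D) (at h0 within I) \<and> sgn \<rho>q * D > 0))"
proof -

  \<comment> \<open>Constants and their signs\<close>
  define a b where "a = L\<theta> * \<epsilon>\<theta>" and "b = L\<phi> * \<epsilon>\<phi>"
  define \<theta>0 \<phi>0 where "\<theta>0 = \<theta>s h0" and "\<phi>0 = \<phi>s h0"
  note base = \<theta>0_def[symmetric] \<phi>0_def[symmetric]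
  have nonneg: "L\<theta> \<ge> 0" "L\<phi> \<ge> 0" "a \<ge> 0" "b \<ge> 0"
    and pos: "\<gamma>\<theta> > 0" "\<gamma>\<phi> > 0"
    using smooth_loss_nonneg[OF smooth\<theta> Theta(3)] smooth_loss_nonneg[OF smooth\<phi> Phi(3)]
      sensitive\<theta> sensitive\<phi> convex\<theta> convex\<phi>
    by (auto simp: a_def b_def sensitive_def strongly_convex_loss_def)
  \<comment> \<open>This sum is the third entry of the maximum \<open>\<kappa>\<close>.\<close>
  have "a / \<gamma>\<theta> + b / \<gamma>\<phi> < 1"
    using \<kappa> by (simp add: a_def b_def)
  note contraction = contraction_constants[OF pos nonneg(3,4) this]
  have \<tau>: "\<tau>q = \<gamma>\<phi> - b - a * b / (\<gamma>\<theta> - a)"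
    by (simp add: \<tau>q a_def b_def mult.assoc)
  have \<alpha>_pos: "\<gamma>\<theta> - a > 0" and \<tau>_pos: "\<tau>q > 0"
    using contraction by (simp_all add: \<tau>)

  \<comment> \<open>Training distributions as probability measures, and their means\<close>
  have mem: "\<theta>s h \<in> \<Theta>" "\<phi>s h \<in> \<Phi>" if "h \<in> I" for h
    using stable[OF that] by (auto simp: stable_point_def is_arg_min_def)
  have mem0: "\<theta>0 \<in> \<Theta>" "\<phi>0 \<in> \<Phi>" and h0: "h0 \<in> I" "h0 \<ge> 0" "h0 < 1"
    using mem range by (auto simp: \<theta>0_def \<phi>0_def)

  have P_prob: "P h t u \<in> space (prob_algebra borel)" if "h \<in> I" "t \<in> \<Theta>" "u \<in> \<Phi>" for h t u
    unfolding P using that real_data synthetic curated weights\<theta>[of h] range(2)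
    by (intro mixture_in_prob_algebra) auto
  have Q_prob: "Q t u \<in> space (prob_algebra borel)" if "t \<in> \<Theta>" "u \<in> \<Phi>" for t u
    unfolding Q using that real_data synthetic curated weights\<phi>
    by (intro mixture_in_prob_algebra) auto
  have borel: "sets M = sets borel" if "M \<in> space (prob_algebra borel)"
    for M :: "('x \<times> 'y) measure"
    using that by (simp add: space_prob_algebra)
  have P_int: "integrable (P h t u) (loss_grad \<Theta> l\<theta> s)"
    and P_eq: "(LINT z|P h t u. loss_grad \<Theta> l\<theta> s z) = wR h *\<^sub>R (LINT z|PR. loss_grad \<Theta> l\<theta> s z)
        + wS h *\<^sub>R (LINT z|PS t u. loss_grad \<Theta> l\<theta> s z) + h *\<^sub>R (LINT z|PH t u. loss_grad \<Theta> l\<theta> s z)"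
    if "h \<in> I" "s \<in> \<Theta>" "t \<in> \<Theta>" "u \<in> \<Phi>" for h s t u
    unfolding P
    using that real_data synthetic curated weights\<theta>[of h] range(2) integrable\<theta>[OF that(2,3,4)]
    by (auto intro!: integrable_mixture integral_mixture borel)
  have Q_int: "integrable (Q t u) (loss_grad \<Phi> l\<phi> s)"
    if "s \<in> \<Phi>" "t \<in> \<Theta>" "u \<in> \<Phi>" for s t u
    unfolding Q using that real_data synthetic curated weights\<phi> integrable\<phi>[OF that]
    by (auto intro!: integrable_mixture borel)

  \<comment> \<open>Partial derivatives of the mean gradients\<close>
  obtain DP where DP: "((\<lambda>(t, u, h). Fp t u h) has_derivative DP)
      (at (\<theta>0, \<phi>0, h0) within \<Theta> \<times> \<Phi> \<times> I)"
    using diff_Fp unfolding base differentiable_def by blast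
  obtain DQ where DQ: "((\<lambda>(t, u). Fq t u) has_derivative DQ) (at (\<theta>0, \<phi>0) within \<Theta> \<times> \<Phi>)"
    using diff_Fq unfolding base differentiable_def by blast
  have DP_lin: "linear DP" and DQ_lin: "linear DQ"
    using DP DQ by (simp_all add: has_derivative_linear)

  \<comment> \<open>Composition with the inclusion of one coordinate turns the total derivative into
    a partial one.\<close>
  have DP_t: "((\<lambda>t. Fp t \<phi>0 h0) has_derivative (\<lambda>x. DP (x, 0, 0))) (at \<theta>0 within \<Theta>)"
    using has_derivative_compose_within[OF has_derivative_Pair[OF has_derivative_ident has_derivative_Pair[OF has_derivative_const has_derivative_const]]
        DP, of \<Theta>] mem0 h0 by simp
  have DP_u: "((\<lambda>u. Fp \<theta>0 u h0) has_derivative (\<lambda>x. DP (0, x, 0))) (at \<phi>0 within \<Phi>)"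
    using has_derivative_compose_within[OF has_derivative_Pair[OF has_derivative_const has_derivative_Pair[OF has_derivative_ident has_derivative_const]]
        DP, of \<Phi>] mem0 h0 by simp
  have DP_h: "((\<lambda>h. Fp \<theta>0 \<phi>0 h) has_derivative (\<lambda>x. DP (0, 0, x))) (at h0 within I)"
    using has_derivative_compose_within[OF has_derivative_Pair[OF has_derivative_const has_derivative_Pair[OF has_derivative_const has_derivative_ident]]
        DP, of I] mem0 h0 by simp
  have DQ_t: "((\<lambda>t. Fq t \<phi>0) has_derivative (\<lambda>x. DQ (x, 0))) (at \<theta>0 within \<Theta>)"
    using has_derivative_compose_within[OF has_derivative_Pair[OF has_derivative_ident has_derivative_const]
        DQ, of \<Theta>] mem0 by simp
  have DQ_u: "((\<lambda>u. Fq \<theta>0 u) has_derivative (\<lambda>x. DQ (0, x))) (at \<phi>0 within \<Phi>)"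
    using has_derivative_compose_within[OF has_derivative_Pair[OF has_derivative_const has_derivative_ident]
        DQ, of \<Phi>] mem0 by simp
  have Jp\<theta>_eq: "Jp\<theta> *v x = DP (x, 0, 0)" for x
    unfolding Jp\<theta> base by (rule jacobian_within_eqI[OF DP_t Theta(2) mem0(1) Theta(3)])
  have Jp\<phi>_eq: "Jp\<phi> *v x = DP (0, x, 0)" for x
    unfolding Jp\<phi> base by (rule jacobian_within_eqI[OF DP_u Phi(2) mem0(2) Phi(3)])
  have Jq\<theta>_eq: "Jq\<theta> *v x = DQ (x, 0)" for x
    unfolding Jq\<theta> base by (rule jacobian_within_eqI[OF DQ_t Theta(2) mem0(1) Theta(3)])
  have Jq\<phi>_eq: "Jq\<phi> *v x = DQ (0, x)" for x
    unfolding Jq\<phi> base by (rule jacobian_within_eqI[OF DQ_u Phi(2) mem0(2) Phi(3)])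

  \<comment> \<open>Estimates for the four Jacobian blocks\<close>
  have Jp\<theta>_coercive: "(Jp\<theta> *v x) \<bullet> x \<ge> (\<gamma>\<theta> - a) * (norm x)\<^sup>2" for x
    unfolding Jp\<theta>_eq a_def
  proof (rule strongly_monotone_derivative[OF DP_t Theta(2) mem0(1) Theta(3)])
    show "(Fp t \<phi>0 h0 - Fp s \<phi>0 h0) \<bullet> (t - s) \<ge> (\<gamma>\<theta> - L\<theta> * \<epsilon>\<theta>) * (norm (t - s))\<^sup>2"
      if "t \<in> \<Theta>" "s \<in> \<Theta>" for t s
      unfolding Fp using P_prob P_int h0 that mem0
      by (intro mean_grad_strongly_monotone[OF _ _ smooth\<theta> nonneg(1) sensitive\<theta> convex\<theta>])
  qed
  have Jp\<phi>_bound: "norm (Jp\<phi> *v x) \<le> a * norm x" for x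
    unfolding Jp\<phi>_eq a_def
  proof (rule lipschitz_derivative[OF DP_u Phi(2) mem0(2) Phi(3)])
    show "norm (Fp \<theta>0 u h0 - Fp \<theta>0 u' h0) \<le> L\<theta> * \<epsilon>\<theta> * norm (u - u')"
      if "u \<in> \<Phi>" "u' \<in> \<Phi>" for u u'
      unfolding Fp using P_prob P_int h0 that mem0
      by (intro mean_grad_lipschitz[OF _ _ smooth\<theta> nonneg(1) sensitive\<theta>])
  qed
  have Jq\<theta>_bound: "norm (Jq\<theta> *v x) \<le> b * norm x" for x
    unfolding Jq\<theta>_eq b_def
  proof (rule lipschitz_derivative[OF DQ_t Theta(2) mem0(1) Theta(3)])
    show "norm (Fq t \<phi>0 - Fq t' \<phi>0) \<le> L\<phi> * \<epsilon>\<phi> * norm (t - t')"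
      if "t \<in> \<Theta>" "t' \<in> \<Theta>" for t t'
      unfolding Fq using Q_prob Q_int that mem0
      by (intro mean_grad_lipschitz[OF _ _ smooth\<phi> nonneg(2) sensitive_swap[OF sensitive\<phi>]])
  qed
  have Jq\<phi>_coercive: "(Jq\<phi> *v x) \<bullet> x \<ge> (\<gamma>\<phi> - b) * (norm x)\<^sup>2" for x
    unfolding Jq\<phi>_eq b_def
  proof (rule strongly_monotone_derivative[OF DQ_u Phi(2) mem0(2) Phi(3)])
    show "(Fq \<theta>0 u - Fq \<theta>0 s) \<bullet> (u - s) \<ge> (\<gamma>\<phi> - L\<phi> * \<epsilon>\<phi>) * (norm (u - s))\<^sup>2"
      if "u \<in> \<Phi>" "s \<in> \<Phi>" for u s
      unfolding Fq using Q_prob Q_int that mem0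
      by (intro mean_grad_strongly_monotone[OF _ _ smooth\<phi> nonneg(2)
            sensitive_swap[OF sensitive\<phi>] convex\<phi>])
  qed

  \<comment> \<open>The Schur complement and its inverse\<close>
  define M where "M = Jq\<phi> - Jq\<theta> ** matrix_inv Jp\<theta> ** Jp\<phi>"
  have Sq_M: "Sq = matrix_inv M"
    by (simp add: Sq M_def)
  have M: "(M *v x) \<bullet> x \<ge> \<tau>q * (norm x)\<^sup>2" for x
    unfolding M_def \<tau>
    by (rule coercive_schur_complement[OF Jp\<theta>_coercive \<alpha>_pos Jp\<phi>_bound Jq\<theta>_bound Jq\<phi>_coercive nonneg(4)])
  have Sq_norm: "norm (Sq *v x) \<le> norm x / \<tau>q" for x
    unfolding Sq_M by (rule coercive_matrix_inv_norm[OF M \<tau>_pos])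
  have "onorm ((*v) Sq) \<le> 1 / \<tau>q"
    using Sq_norm \<tau>_pos by (intro onorm_bound) auto
  moreover
  have "\<exists>D. ((\<lambda>h. Jq (\<phi>s h)) has_real_derivative D) (at h0 within I) \<and> sgn \<rho>q * D > 0"
    if nz: "gJ \<noteq> 0" "v \<noteq> 0" and \<rho>: "\<bar>\<rho>q\<bar> > 1 / sqrt (1 + mq\<^sup>2 * \<tau>q\<^sup>2)"
  proof -

    \<comment> \<open>Differentiation of the stationarity equations\<close>
    obtain \<theta>d where \<theta>d: "(\<theta>s has_derivative \<theta>d) (at h0 within I)"
      using diff_stable unfolding differentiable_def by blast
    obtain \<phi>d where \<phi>d: "(\<phi>s has_derivative \<phi>d) (at h0 within I)"
      using diff_stable unfolding differentiable_def by blast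
    obtain h1 where h1: "h1 \<in> I" "h1 \<noteq> h0"
      using range(4) by blast
    \<comment> \<open>As \<open>h0\<close> may be an endpoint of \<open>I\<close>, derivatives are
      compared only in the direction \<open>k\<close> of another weight; \<open>k\<close> may be
      negative.\<close>
    define k where "k = h1 - h0"
    have "convex I"
      using range(1) by (rule is_interval_convex)
    note dir_unique = has_derivative_within_convex_unique_on[OF _ _ this h0(1) h1(1), folded k_def]

    have "((\<lambda>h. Fp (\<theta>s h) (\<phi>s h) h) has_derivative (\<lambda>x. DP (\<theta>d x, \<phi>d x, x))) (at h0 within I)"
      using has_derivative_compose_within[OF has_derivative_Pair[OF \<theta>d has_derivative_Pair[OF \<phi>d has_derivative_ident]]
          DP[unfolded \<theta>0_def \<phi>0_def]] mem by simp
    moreover have "((\<lambda>h. Fp (\<theta>s h) (\<phi>s h) h) has_derivative (\<lambda>x. 0)) (at h0 within I)"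
      using zero by (intro has_derivative_transform[OF h0(1) _ has_derivative_const]) auto
    ultimately have DP_0: "DP (\<theta>d k, \<phi>d k, k) = 0"
      by (rule dir_unique)
    have "((\<lambda>h. Fq (\<theta>s h) (\<phi>s h)) has_derivative (\<lambda>x. DQ (\<theta>d x, \<phi>d x))) (at h0 within I)"
      using has_derivative_compose_within[OF has_derivative_Pair[OF \<theta>d \<phi>d]
          DQ[unfolded \<theta>0_def \<phi>0_def]] mem by simp
    moreover have "((\<lambda>h. Fq (\<theta>s h) (\<phi>s h)) has_derivative (\<lambda>x. 0)) (at h0 within I)"
      using zero by (intro has_derivative_transform[OF h0(1) _ has_derivative_const]) auto
    ultimately have DQ_0: "DQ (\<theta>d k, \<phi>d k) = 0"
      by (rule dir_unique)

    \<comment> \<open>With the ratio \<open>wS : wR\<close> fixed, the uncurated part of the mean gradient is \<open>(1 - h) A\<close>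
      for a constant \<open>A\<close>; since the mean gradient vanishes at \<open>h0\<close>, \<open>(1 - h0) (B - A) = B\<close>.\<close>
    define B where "B = (LINT z|PH \<theta>0 \<phi>0. loss_grad \<Theta> l\<theta> \<theta>0 z)"
    define A where "A = (wR h0 / (1 - h0)) *\<^sub>R (LINT z|PR. loss_grad \<Theta> l\<theta> \<theta>0 z)
        + (wS h0 / (1 - h0)) *\<^sub>R (LINT z|PS \<theta>0 \<phi>0. loss_grad \<Theta> l\<theta> \<theta>0 z)"
    have wS: "wS h = (1 - h) * (wS h0 / (1 - h0))" and wR: "wR h = (1 - h) * (wR h0 / (1 - h0))"
      if "h \<in> I" for h
    proof -
      have s: "wR h = 1 - h - wS h" "wR h0 = 1 - h0 - wS h0"
        using weights\<theta>[OF that] weights\<theta>[OF h0(1)] by simp_all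
      \<comment> \<open>After eliminating \<open>wR\<close>, the products
        \<open>wS h * wS h0\<close> cancel in the cross-multiplied ratio.\<close>
      have "wS h * (1 - h0) = (1 - h) * wS h0"
        using ratio[OF that h0(1)] unfolding s by (simp add: algebra_simps)
      moreover from this have "wR h * (1 - h0) = (1 - h) * wR h0"
        unfolding s by (simp add: algebra_simps)
      ultimately show "wS h = (1 - h) * (wS h0 / (1 - h0))" "wR h = (1 - h) * (wR h0 / (1 - h0))"
        using h0(3) by (simp_all add: eq_divide_eq)
    qed
    have Fp_h: "Fp \<theta>0 \<phi>0 h = (1 - h) *\<^sub>R A + h *\<^sub>R B" if "h \<in> I" for h
      unfolding Fp P_eq[OF that mem0(1) mem0] A_def B_def wS[OF that] wR[OF that]
      by (simp add: scaleR_add_right)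
    have "((\<lambda>h. A + h *\<^sub>R (B - A)) has_derivative (\<lambda>x. x *\<^sub>R (B - A))) (at h0 within I)"
      by (auto intro!: derivative_eq_intros)
    then have "((\<lambda>h. Fp \<theta>0 \<phi>0 h) has_derivative (\<lambda>x. x *\<^sub>R (B - A))) (at h0 within I)"
    proof (rule has_derivative_transform[OF h0(1), rotated])
      show "Fp \<theta>0 \<phi>0 h = A + h *\<^sub>R (B - A)" if "h \<in> I" for h
        using Fp_h[OF that] by (simp add: algebra_simps)
    qed
    with DP_h have DP_k: "DP (0, 0, k) = k *\<^sub>R (B - A)"
      by (rule dir_unique)
    have "(1 - h0) *\<^sub>R A + h0 *\<^sub>R B = 0"
      using Fp_h[OF h0(1)] zero[OF h0(1)] by (simp add: base)
    then have scaled: "(1 - h0) *\<^sub>R (B - A) = B"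
      by (simp add: algebra_simps)
    have "B - A = (1 / (1 - h0)) *\<^sub>R ((1 - h0) *\<^sub>R (B - A))"
      using h0(3) by simp
    then have BA: "B - A = (1 / (1 - h0)) *\<^sub>R B"
      by (simp only: scaled)

    \<comment> \<open>Solving the linearised system for the velocity of
      \<open>\<phi>s\<close>\<close>
    have "DP (\<theta>d k, \<phi>d k, k) = DP (\<theta>d k, 0, 0) + DP (0, \<phi>d k, 0) + DP (0, 0, k)"
      using linear_add[OF DP_lin, of "(\<theta>d k, 0, 0)" "(0, \<phi>d k, 0)"]
        linear_add[OF DP_lin, of "(\<theta>d k, \<phi>d k, 0)" "(0, 0, k)"] by simp
    then have eq1: "Jp\<theta> *v \<theta>d k + Jp\<phi> *v \<phi>d k = (- k / (1 - h0)) *\<^sub>R B"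
      unfolding Jp\<theta>_eq Jp\<phi>_eq using DP_0 by (simp add: DP_k BA add_eq_0_iff2)
    have eq2: "Jq\<theta> *v \<theta>d k + Jq\<phi> *v \<phi>d k = 0"
      unfolding Jq\<theta>_eq Jq\<phi>_eq using DQ_0 linear_add[OF DQ_lin, of "(\<theta>d k, 0)" "(0, \<phi>d k)"]
      by simp
    \<comment> \<open>The minus sign in \<open>Cq\<close> cancels that of the negative loss
      gradient; the distributive laws at 0 pull both signs out.\<close>
    have v_B: "v = Jq\<theta> *v (matrix_inv Jp\<theta> *v B)"
      unfolding v Cq base B_def
      using matrix_vector_mult_diff_rdistrib[of 0 "Jq\<theta> ** matrix_inv Jp\<theta>"]
        matrix_vector_mult_diff_distrib[of "Jq\<theta> ** matrix_inv Jp\<theta>" 0]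
      by (simp add: matrix_vector_mul_assoc)
    have \<phi>d_scale: "\<phi>d x = x *\<^sub>R \<phi>d 1" for x
      using linear_cmul[OF has_derivative_linear[OF \<phi>d], of x 1] by simp
    have "M *v \<phi>d k = (k / (1 - h0)) *\<^sub>R v"
      unfolding M_def schur_complement_solve[OF Jp\<theta>_coercive \<alpha>_pos eq1 eq2] v_B
        matrix_vector_mult_scaleR
      by simp
    then have "\<phi>d k = k *\<^sub>R ((1 / (1 - h0)) *\<^sub>R (Sq *v v))"
      using coercive_matrix_inv_left[OF M \<tau>_pos, of "\<phi>d k"]
      by (simp add: Sq_M matrix_vector_mult_scaleR)
    then have "k *\<^sub>R \<phi>d 1 = k *\<^sub>R ((1 / (1 - h0)) *\<^sub>R (Sq *v v))"
      by (simp only: \<phi>d_scale[of k, symmetric])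
    \<comment> \<open>Cancelling \<open>k \<noteq> 0\<close> removes the dependence on the auxiliary
      weight \<open>h1\<close>.\<close>
    then have \<phi>d_1: "\<phi>d 1 = (1 / (1 - h0)) *\<^sub>R (Sq *v v)"
      by (rule scaleR_left_imp_eq[rotated]) (use h1(2) in \<open>simp add: k_def\<close>)

    \<comment> \<open>Sign of the derivative of the expected reward\<close>
    have "(Jq has_derivative (\<lambda>x. gJ \<bullet> x)) (at (\<phi>s h0) within \<Phi>)"
      unfolding gJ using diff_Jq Phi(2,3) mem(2)[OF h0(1)] by (intro has_derivative_grad_within)
    from has_derivative_compose_within[OF \<phi>d this mem(2)]
    have "((\<lambda>h. Jq (\<phi>s h)) has_derivative (\<lambda>x. gJ \<bullet> \<phi>d x)) (at h0 within I)" .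
    then have deriv: "((\<lambda>h. Jq (\<phi>s h)) has_real_derivative gJ \<bullet> \<phi>d 1) (at h0 within I)"
    proof (rule has_derivative_imp_has_field_derivative)
      show "x * (gJ \<bullet> \<phi>d 1) = gJ \<bullet> \<phi>d x" for x
        unfolding \<phi>d_scale[of x] by simp
    qed
    have m_pos: "mq > 0" and m_bound: "(Sq *v v) \<bullet> v \<ge> mq * (norm v)\<^sup>2"
      unfolding mq Sq_M
      using coercive_min_eigenvalue_inv_pos[OF M \<tau>_pos] coercive_min_eigenvalue_inv_bound[OF M \<tau>_pos]
      by blast+
    have "sgn \<rho>q * (gJ \<bullet> (Sq *v v)) > 0"
      unfolding \<rho>q using nz m_pos \<tau>_pos m_bound Sq_norm \<rho>[unfolded \<rho>q]
      by (rule sgn_inner_pos_of_cosine)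
    \<comment> \<open>The remaining factor \<open>1 / (1 - h0)\<close> is positive because
      \<open>h0 < 1\<close>.\<close>
    then have "sgn \<rho>q * (gJ \<bullet> \<phi>d 1) > 0"
      using h0(3) by (simp add: \<phi>d_1)
    with deriv show ?thesis
      by blast
  qed
  ultimately show ?thesis
    by blast
qed

end
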